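(* Let $X$ be a complex Banach space and $P:\mathbb{C}^n\to X$ an $m$-homogeneous tetrahedral polynomial with associated symmetric $m$-linear operator $M$. For every $1\le p<\infty$, \[ \big(\mathbb{E}\|P(w)\|^p\big)^{1/p}\le\frac\pi2\sqrt{em}\,\big(\mathbb{E}\|M(w',w,\ldots,w)\|^p\big)^{1/p}. \] If moreover $X$ is $K$-convex and $1<p<\infty$, then \[ \sqrt m\big(\mathbb{E}\|M(w',w,\ldots,w)\|^p\big)^{1/p}\le\frac\pi2\sqrt e\,K_p(X)\big(\mathbb{E}\|P(w)\|^p\big)^{1/p}. \]
   Context: $P(z)=\sum_{A\subseteq[n],|A|=m}x_Az_A$, $z_A=\prod_{k\in A}z_k$; $M$ is the unique symmetric $m$-linear map with $M(z,\dots,z)=P(z)$. $w,w'$ are independent random vectors with independent Steinhaus coordinates (uniform on the unit circle). The Rademacher projection $R$ acts on $X$-valued Walsh polynomials $\sum_Ax_A\varepsilon_A$ ($\varepsilon_A=\prod_{i\in A}\varepsilon_i$, $\varepsilon_i$ independent Rademacher) by $R(\sum_Ax_A\varepsilon_A)=\sum_{|A|=1}x_A\varepsilon_A$; $X$ is $K$-convex if $R$ extends to a bounded operator on $L^2(\{-1,1\}^\infty,X)$ (equivalently on $L^p$ for every $1<p<\infty$), and $K_p(X)$ denotes the norm of $R$ on $L^p(\{-1,1\}^\infty,X)$. *)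

theory Defs
  imports "HOL-Probability.Probability"
begin

class complex_normed_vector = real_normed_vector +
  fixes scaleC :: "complex \<Rightarrow> 'a \<Rightarrow> 'a" (infixr \<open>*\<^sub>C\<close> 75)
  assumes scaleC_add_right: "a *\<^sub>C (x + y) = a *\<^sub>C x + a *\<^sub>C y"
    and scaleC_add_left: "(a + b) *\<^sub>C x = a *\<^sub>C x + b *\<^sub>C x"
    and scaleC_scaleC: "a *\<^sub>C (b *\<^sub>C x) = (a * b) *\<^sub>C x"
    and scaleC_one: "1 *\<^sub>C x = x"
    and scaleR_scaleC: "scaleR r x = complex_of_real r *\<^sub>C x"
    and norm_scaleC: "norm (a *\<^sub>C x) = cmod a * norm x"

definition tetra_index :: "nat \<Rightarrow> nat \<Rightarrow> nat set set" where
  "tetra_index n m = {A. A \<subseteq> {..<n} \<and> card A = m}"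

definition tetra_poly ::
  "nat \<Rightarrow> nat \<Rightarrow> (nat set \<Rightarrow> 'a::complex_normed_vector) \<Rightarrow> (nat \<Rightarrow> complex) \<Rightarrow> 'a" where
  "tetra_poly n m x z = (\<Sum>A\<in>tetra_index n m. (\<Prod>k\<in>A. z k) *\<^sub>C x A)"

text \<open>The unique symmetric m-linear map M with M(z,...,z) = P(z), written out:
M(z_0,...,z_{m-1}) = (1/m!) sum over injective f:[m]->[n] of
(prod_j z_j(f j)) x_{f([m])}.  Argument j is the vector zs j.\<close>
definition tetra_sym ::
  "nat \<Rightarrow> nat \<Rightarrow> (nat set \<Rightarrow> 'a::complex_normed_vector) \<Rightarrow> (nat \<Rightarrow> nat \<Rightarrow> complex) \<Rightarrow> 'a" where
  "tetra_sym n m x zs =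
     (complex_of_real (1 / fact m)) *\<^sub>C
       (\<Sum>f\<in>{f. f \<in> {..<m} \<rightarrow>\<^sub>E {..<n} \<and> inj_on f {..<m}}.
          (\<Prod>j<m. zs j (f j)) *\<^sub>C x (f ` {..<m}))"

definition steinhaus :: "complex measure" where
  "steinhaus = distr (uniform_measure lborel {0..2*pi}) borel cis"

definition steinhaus_vec :: "nat \<Rightarrow> (nat \<Rightarrow> complex) measure" where
  "steinhaus_vec n = PiM {..<n} (\<lambda>_. steinhaus)"

text \<open>A Walsh polynomial in the first N Rademacher variables is given by coefficients
x_A, A subseteq [N].  A point of {-1,1}^N is encoded by the set S of coordinates
equal to -1.  The L^p norm on {-1,1}^infinity of a function depending on the first N
coordinates is the normalized p-average over {-1,1}^N.\<close>
definition rad_sign :: "nat set \<Rightarrow> nat \<Rightarrow> real" where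
  "rad_sign S i = (if i \<in> S then -1 else 1)"

definition walsh :: "nat \<Rightarrow> (nat set \<Rightarrow> 'a::real_normed_vector) \<Rightarrow> nat set \<Rightarrow> 'a" where
  "walsh N x S = (\<Sum>A\<in>Pow {..<N}. (\<Prod>i\<in>A. rad_sign S i) *\<^sub>R x A)"

definition rad_proj :: "nat \<Rightarrow> (nat set \<Rightarrow> 'a::real_normed_vector) \<Rightarrow> nat set \<Rightarrow> 'a" where
  "rad_proj N x S = (\<Sum>i<N. rad_sign S i *\<^sub>R x {i})"

definition Lp_cube :: "nat \<Rightarrow> real \<Rightarrow> (nat set \<Rightarrow> 'a::real_normed_vector) \<Rightarrow> real" where
  "Lp_cube N p f = ((\<Sum>S\<in>Pow {..<N}. norm (f S) powr p) / 2 ^ N) powr (1 / p)"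

definition K_convex :: "'a::real_normed_vector itself \<Rightarrow> bool" where
  "K_convex _ \<longleftrightarrow> (\<exists>C. \<forall>N (x :: nat set \<Rightarrow> 'a).
      Lp_cube N 2 (rad_proj N x) \<le> C * Lp_cube N 2 (walsh N x))"

text \<open>K_p(X): the norm of R on L^p, i.e. the supremum of ||Rf||_p / ||f||_p over nonzero
Walsh polynomials f (which are dense, so this is the norm of the extension).\<close>
definition K_const :: "real \<Rightarrow> 'a::real_normed_vector itself \<Rightarrow> real" where
  "K_const p _ = Sup {Lp_cube N p (rad_proj N x) / Lp_cube N p (walsh N x) | N (x :: nat set \<Rightarrow> 'a).
      Lp_cube N p (walsh N x) \<noteq> 0}"

end

theory Submission
  imports Defs
begin

text \<open>
  Substitute into \<open>P\<close> the unimodular multipliers \<open>v\<^sub>k = c + i s \<epsilon>\<^sub>k\<close> with \<open>s\<^sup>2 = 1/m\<close>, \<open>c\<^sup>2 = 1 - 1/m\<close>.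
  The level-one Walsh part of \<open>\<epsilon> \<mapsto> P(v w)\<close> is \<open>i s c\<^sup>m\<^sup>-\<^sup>1\<close> times
  \<open>g(w, \<epsilon>) = \<Sum>\<^sub>k \<epsilon>\<^sub>k w\<^sub>k \<partial>\<^sub>k P(w)\<close>, and conversely averaging \<open>g(v w, \<epsilon>)\<close> over \<open>\<epsilon>\<close> returns
  \<open>i m s c\<^sup>m\<^sup>-\<^sup>1 P(w)\<close>. As \<open>v w\<close> has the law of \<open>w\<close>, this compares the norms of \<open>P(w)\<close> and \<open>g(w, \<epsilon>)\<close>
  in both directions, with \<open>c\<^sup>m\<^sup>-\<^sup>1 \<ge> e\<^sup>-\<^sup>1\<^sup>/\<^sup>2\<close>. Since \<open>m M(w', w, \<dots>, w) = \<Sum>\<^sub>k w'\<^sub>k \<partial>\<^sub>k P(w)\<close>,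
  the complex contraction principle with constant \<open>\<pi>/2\<close> replaces \<open>\<epsilon>\<^sub>k w\<^sub>k\<close> by \<open>w'\<^sub>k\<close>.

  The supremum defining \<open>K\<^sub>p(X)\<close> must be shown finite, as a supremum of an unbounded set is a junk
  value. With a noise operator \<open>T\<close> of correlation \<open>1/2\<close>, a power \<open>T\<^sup>k\<close> is contractive from \<open>L\<^sup>2\<close> to
  \<open>L\<^sup>q\<close> and dually from \<open>L\<^sup>q\<^sup>'\<close> to \<open>L\<^sup>2\<close>, even for vector-valued functions since its kernel is
  positive, and it acts on the range of \<open>R\<close> as \<open>2\<^sup>-\<^sup>k\<close>, so boundedness of \<open>R\<close> passes from \<open>L\<^sup>2\<close> to \<open>L\<^sup>p\<close>.
\<close>

section \<open>Hypercontractivity on the cube\<close>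

lemma sum_Pow_lessThan_Suc:
  "(\<Sum>S\<in>Pow {..<Suc N}. f S) = (\<Sum>S\<in>Pow {..<N}. f S + (f (insert N S) :: 'b::comm_monoid_add))"
proof -
  have "inj_on (insert N) (Pow {..<N})"
    by (rule inj_onI) (metis Diff_insert_absorb Pow_iff lessThan_iff less_irrefl subsetD)
  moreover have "Pow {..<N} \<inter> insert N ` Pow {..<N} = {}" by auto
  ultimately show ?thesis
    by (simp add: lessThan_Suc Pow_insert sum.union_disjoint sum.reindex sum.distrib)
qed

text \<open>Independence of the coordinates: the sum over the cube factorises one coordinate at a
  time. The noise kernel and the averages of \<open>cube_rot\<close> are computed with it.\<close>

lemma prod_rad_sign_expand:
  fixes h :: "nat \<Rightarrow> real \<Rightarrow> 'b::comm_semiring_1"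
  shows "(\<Sum>S\<in>Pow {..<N}. \<Prod>i<N. h i (rad_sign S i)) = (\<Prod>i<N. h i 1 + h i (-1))"
proof (induction N)
  case (Suc N)
  have "(\<Prod>i<N. h i (rad_sign (insert N S) i)) = (\<Prod>i<N. h i (rad_sign S i))" for S
    by (rule prod.cong) (auto simp: rad_sign_def)
  moreover have "N \<notin> S" if "S \<in> Pow {..<N}" for S
    using that by auto
  ultimately have "(\<Sum>S\<in>Pow {..<Suc N}. \<Prod>i<Suc N. h i (rad_sign S i))
     = (\<Sum>S\<in>Pow {..<N}. (\<Prod>i<N. h i (rad_sign S i)) * (h N 1 + h N (-1)))"
    unfolding sum_Pow_lessThan_Suc by (intro sum.cong) (auto simp: rad_sign_def algebra_simps)
  then show ?case by (simp add: Suc.IH flip: sum_distrib_right)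
qed simp

text \<open>The noise operator T of correlation 1/2: the mean of f after each sign of S has been
  flipped independently with probability 1/4. The kernel is a probability weight in S', so no
  further division by 2^N is due.\<close>

definition noise :: "nat \<Rightarrow> (nat set \<Rightarrow> 'a::real_vector) \<Rightarrow> nat set \<Rightarrow> 'a" where
  "noise N f S = (\<Sum>S'\<in>Pow {..<N}.
     (\<Prod>i<N. (1 + rad_sign S i * rad_sign S' i / 2) / 2) *\<^sub>R f S')"

definition cube_avg :: "nat \<Rightarrow> (nat set \<Rightarrow> real) \<Rightarrow> real" where
  "cube_avg N f = (\<Sum>S\<in>Pow {..<N}. f S) / 2 ^ N"

lemma noise_kernel_nonneg: "0 \<le> (\<Prod>i<N. (1 + rad_sign S i * rad_sign S' i / 2) / 2)"
  by (rule prod_nonneg) (auto simp: rad_sign_def)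

lemma noise_kernel_sum: "(\<Sum>S'\<in>Pow {..<N}. \<Prod>i<N. (1 + rad_sign S i * rad_sign S' i / 2) / 2) = 1"
  using prod_rad_sign_expand[of "\<lambda>i t. (1 + rad_sign S i * t / 2) / 2" N] by (simp add: field_simps)

text \<open>In a coordinate of A the averaging multiplies the sign by 1/2, and elsewhere it
  preserves the constant 1. The product over A is extended by factors 1 to all coordinates so that
  the sum over the cube factorises.\<close>

lemma noise_walsh_char:
  assumes "A \<subseteq> {..<N}"
  shows "noise N (\<lambda>S. (\<Prod>i\<in>A. rad_sign S i) *\<^sub>R x) S
    = ((1/2) ^ card A * (\<Prod>i\<in>A. rad_sign S i)) *\<^sub>R x"
proof -
  have *: "(\<Prod>i\<in>A. f i) = (\<Prod>i<N. if i \<in> A then f i else 1)" for f :: "nat \<Rightarrow> real"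
    using assms by (simp add: prod.If_cases Int_absorb1)
  have "(\<Sum>S'\<in>Pow {..<N}. (\<Prod>i<N. (1 + rad_sign S i * rad_sign S' i / 2) / 2) * (\<Prod>i\<in>A. rad_sign S' i))
    = (\<Sum>S'\<in>Pow {..<N}. \<Prod>i<N. (1 + rad_sign S i * rad_sign S' i / 2) / 2 * (if i \<in> A then rad_sign S' i else 1))"
    by (simp only: * prod.distrib)
  also have "\<dots> = (\<Prod>i<N. if i \<in> A then 1/2 * rad_sign S i else 1)"
    by (subst prod_rad_sign_expand[of "\<lambda>i t. (1 + rad_sign S i * t / 2) / 2 * (if i \<in> A then t else 1)" N])
       (intro prod.cong, auto simp: field_simps)
  also have "\<dots> = (\<Prod>i\<in>A. 1/2 * rad_sign S i)" by (simp only: *)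
  also have "\<dots> = (1/2) ^ card A * (\<Prod>i\<in>A. rad_sign S i)"
    by (simp add: prod.distrib prod_dividef power_one_over)
  finally show ?thesis
    by (simp add: noise_def flip: scaleR_sum_left)
qed

lemma noise_sum: "noise N (\<lambda>S. \<Sum>A\<in>I. f A S) S = (\<Sum>A\<in>I. noise N (f A) S)"
  unfolding noise_def scaleR_sum_right by (rule sum.swap)

lemma noise_walsh: "noise N (walsh N x) = walsh N (\<lambda>A. (1/2) ^ card A *\<^sub>R x A)"
  unfolding walsh_def[abs_def] noise_sum
  by (intro ext sum.cong refl, subst noise_walsh_char) (auto simp: mult.commute)

lemma rad_proj_eq_walsh: "rad_proj N x = walsh N (\<lambda>A. if card A = 1 then x A else 0)"
proof
  fix S
  have "walsh N (\<lambda>A. if card A = 1 then x A else 0) S =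
     (\<Sum>A\<in>(\<lambda>i. {i}) ` {..<N}. (\<Prod>i\<in>A. rad_sign S i) *\<^sub>R x A)"
    unfolding walsh_def by (rule sum.mono_neutral_cong_right) (auto simp: card_1_singleton_iff)
  also have "\<dots> = rad_proj N x S"
    by (subst sum.reindex) (auto simp: rad_proj_def)
  finally show "rad_proj N x S = walsh N (\<lambda>A. if card A = 1 then x A else 0) S" ..
qed

lemma funpow_noise_walsh:
  "(noise N ^^ k) (walsh N x) = walsh N (\<lambda>A. ((1/2) ^ card A) ^ k *\<^sub>R x A)"
  by (induction k) (auto simp: noise_walsh)

text \<open>Only characters of degree one occur in the range of R, so T^k can be undone there at the
  price of a factor 2^k that does not depend on N.\<close>

lemma funpow_noise_rad_proj: "(noise N ^^ k) (rad_proj N x) S = (1/2) ^ k *\<^sub>R rad_proj N x S"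
  unfolding rad_proj_eq_walsh funpow_noise_walsh
  by (auto simp: walsh_def scaleR_sum_right intro!: sum.cong)

text \<open>Positivity of the kernel makes the scalar operator applied to the norms a majorant; this
  is how scalar hypercontractivity reaches vector-valued functions.\<close>

lemma norm_noise_le: "norm (noise N f S) \<le> noise N (\<lambda>S. norm (f S)) S"
  unfolding noise_def
  by (rule order_trans[OF norm_sum]) (simp add: abs_of_nonneg[OF noise_kernel_nonneg])

lemma noise_mono:
  fixes f g :: "nat set \<Rightarrow> real"
  assumes "\<And>S. f S \<le> g S"
  shows "noise N f S \<le> noise N g S"
  unfolding noise_def using assms
  by (auto intro!: sum_mono mult_left_mono noise_kernel_nonneg)

lemma noise_nonneg:
  fixes f :: "nat set \<Rightarrow> real"
  assumes "\<And>S. 0 \<le> f S"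
  shows "0 \<le> noise N f S"
  unfolding noise_def using assms
  by (auto intro!: sum_nonneg mult_nonneg_nonneg noise_kernel_nonneg)

lemma norm_funpow_noise_le: "norm ((noise N ^^ k) f S) \<le> (noise N ^^ k) (\<lambda>S. norm (f S)) S"
proof (induction k arbitrary: S)
  case (Suc k)
  show ?case
    using norm_noise_le[of N "(noise N ^^ k) f" S] noise_mono[of "\<lambda>S. norm ((noise N ^^ k) f S)", OF Suc.IH]
    by (auto intro: order_trans)
qed simp

lemma funpow_noise_nonneg:
  fixes f :: "nat set \<Rightarrow> real"
  assumes "\<And>S. 0 \<le> f S"
  shows "0 \<le> (noise N ^^ k) f S"
  by (induction k arbitrary: S) (auto intro: noise_nonneg assms)

section \<open>Bonami's inequality and its iteration\<close>

lemma noise_Suc: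
  assumes "S \<subseteq> {..<N}"
  shows "noise (Suc N) f S = noise N (\<lambda>S'. (3/4) *\<^sub>R f S' + (1/4) *\<^sub>R f (insert N S')) S"
    and "noise (Suc N) f (insert N S) = noise N (\<lambda>S'. (1/4) *\<^sub>R f S' + (3/4) *\<^sub>R f (insert N S')) S"
proof -
  have *: "(\<Prod>i<N. (1 + rad_sign (insert N S) i * rad_sign S' i / 2) / 2) = (\<Prod>i<N. (1 + rad_sign S i * rad_sign S' i / 2) / 2)"
    "(\<Prod>i<N. (1 + rad_sign S i * rad_sign (insert N S') i / 2) / 2) = (\<Prod>i<N. (1 + rad_sign S i * rad_sign S' i / 2) / 2)"
    for S S' by (auto intro!: prod.cong simp: rad_sign_def)
  have N: "N \<notin> S" "\<And>S'. S' \<in> Pow {..<N} \<Longrightarrow> N \<notin> S'" using assms by auto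
  show "noise (Suc N) f S = noise N (\<lambda>S'. (3/4) *\<^sub>R f S' + (1/4) *\<^sub>R f (insert N S')) S"
    unfolding noise_def sum_Pow_lessThan_Suc using N
    by (intro sum.cong refl) (auto simp: * rad_sign_def scaleR_add_right)
  show "noise (Suc N) f (insert N S) = noise N (\<lambda>S'. (1/4) *\<^sub>R f S' + (3/4) *\<^sub>R f (insert N S')) S"
    unfolding noise_def sum_Pow_lessThan_Suc using N
    by (intro sum.cong refl) (auto simp: * rad_sign_def scaleR_add_right)
qed

lemma noise_linear:
  "noise N (\<lambda>S. a *\<^sub>R f S + b *\<^sub>R g S) S = a *\<^sub>R noise N f S + b *\<^sub>R noise N g S"
  unfolding noise_def
  by (simp add: scaleR_add_right sum.distrib scaleR_sum_right mult.commute)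

lemma cube_avg_Suc: "cube_avg (Suc N) f = cube_avg N (\<lambda>S. (f S + f (insert N S)) / 2)"
  unfolding cube_avg_def sum_Pow_lessThan_Suc by (simp add: sum_divide_distrib)

lemma cube_avg_mono: "(\<And>S. S \<subseteq> {..<N} \<Longrightarrow> f S \<le> g S) \<Longrightarrow> cube_avg N f \<le> cube_avg N g"
  unfolding cube_avg_def by (auto intro!: divide_right_mono sum_mono)

lemma cube_avg_nonneg: "(\<And>S. S \<subseteq> {..<N} \<Longrightarrow> 0 \<le> f S) \<Longrightarrow> 0 \<le> cube_avg N f"
  unfolding cube_avg_def by (intro divide_nonneg_pos sum_nonneg) auto

lemma cube_avg_linear:
  "cube_avg N (\<lambda>S. f S + g S) = cube_avg N f + cube_avg N g"
  "cube_avg N (\<lambda>S. c * f S) = c * cube_avg N f"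
  unfolding cube_avg_def by (simp_all add: sum.distrib sum_distrib_left add_divide_distrib)

lemma cube_avg_Cauchy_Schwarz:
  "(cube_avg N (\<lambda>S. f S * g S))\<^sup>2 \<le> cube_avg N (\<lambda>S. (f S)\<^sup>2) * cube_avg N (\<lambda>S. (g S)\<^sup>2)"
  unfolding cube_avg_def
  using divide_right_mono[OF Cauchy_Schwarz_ineq_sum[of f g "Pow {..<N}"], of "(2^N)\<^sup>2"]
  by (simp add: power_divide power2_eq_square)

text \<open>Bonami's hypercontractive inequality. The exponent \<open>4\<close> lets the cross term of the induction
  step be handled by Cauchy-Schwarz; higher powers of two follow by Jensen's inequality for the kernel.\<close>
lemma noise_L2_L4:
  fixes f :: "nat set \<Rightarrow> real"
  shows "cube_avg N (\<lambda>S. (noise N f S) ^ 4) \<le> (cube_avg N (\<lambda>S. (f S)\<^sup>2))\<^sup>2"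
proof (induction N arbitrary: f)
  case 0
  then show ?case by (simp add: cube_avg_def noise_def)
next
  case (Suc N)
  \<comment> \<open>This is the decomposition f = f0 + \<epsilon> f1 with respect to the last sign
    \<epsilon>; the noise operator in N + 1 coordinates turns it into a + \<epsilon> b / 2.\<close>
  define f0 where "f0 S = (f S + f (insert N S)) / 2" for S
  define f1 where "f1 S = (f S - f (insert N S)) / 2" for S
  define a b where "a = noise N f0" and "b = noise N f1"
  have f: "f S = f0 S + f1 S" "f (insert N S) = f0 S - f1 S" for S
    by (simp_all add: f0_def f1_def field_simps)
  have f01: "(3/4) *\<^sub>R f S + (1/4) *\<^sub>R f (insert N S) = 1 *\<^sub>R f0 S + (1/2) *\<^sub>R f1 S"
    "(1/4) *\<^sub>R f S + (3/4) *\<^sub>R f (insert N S) = 1 *\<^sub>R f0 S + (-1/2) *\<^sub>R f1 S" for S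
    by (simp_all add: f0_def f1_def field_simps)
  have T: "noise (Suc N) f S = a S + b S / 2" "noise (Suc N) f (insert N S) = a S - b S / 2"
    if "S \<subseteq> {..<N}" for S
    using noise_Suc[OF that, of f] by (simp_all only: f01 noise_linear a_def b_def) simp_all
  define F where "F = cube_avg N (\<lambda>S. (f0 S)\<^sup>2)"
  define G where "G = cube_avg N (\<lambda>S. (f1 S)\<^sup>2)"
  have FG: "F \<ge> 0" "G \<ge> 0" by (auto simp: F_def G_def intro: cube_avg_nonneg)
  have L: "cube_avg (Suc N) (\<lambda>S. (f S)\<^sup>2) = F + G"
    unfolding cube_avg_Suc F_def G_def cube_avg_linear(1)[symmetric]
    by (rule arg_cong[where f = "cube_avg N"], rule ext)
      (simp add: f0_def f1_def power2_eq_square field_simps)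
  have A: "cube_avg N (\<lambda>S. a S ^ 4) \<le> F\<^sup>2" "cube_avg N (\<lambda>S. b S ^ 4) \<le> G\<^sup>2"
    unfolding a_def b_def F_def G_def by (rule Suc.IH)+
  have "(cube_avg N (\<lambda>S. (a S)\<^sup>2 * (b S)\<^sup>2))\<^sup>2 \<le> F\<^sup>2 * G\<^sup>2"
    by (rule order_trans[OF cube_avg_Cauchy_Schwarz])
       (use A in \<open>auto intro!: mult_mono cube_avg_nonneg simp flip: power_mult\<close>)
  then have M: "cube_avg N (\<lambda>S. (a S)\<^sup>2 * (b S)\<^sup>2) \<le> F * G"
    using FG by (auto simp flip: power_mult_distrib intro: power2_le_imp_le)
  have "cube_avg (Suc N) (\<lambda>S. (noise (Suc N) f S) ^ 4)
     \<le> cube_avg N (\<lambda>S. a S ^ 4 + (2 * ((a S)\<^sup>2 * (b S)\<^sup>2) + b S ^ 4))"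
    unfolding cube_avg_Suc
  proof (rule cube_avg_mono)
    fix S :: "nat set" assume S: "S \<subseteq> {..<N}"
    have "((a S + b S / 2) ^ 4 + (a S - b S / 2) ^ 4) / 2 = a S ^ 4 + 3/2 * ((a S)\<^sup>2 * (b S)\<^sup>2) + b S ^ 4 / 16"
      by (simp add: power4_eq_xxxx power2_eq_square field_simps)
    \<comment> \<open>The odd powers of b have cancelled between the two values of the last sign.
      Enlarging 3/2 to 2 and 1/16 to 1 leaves exactly the terms that assemble to (F + G)^2.\<close>
    also have "\<dots> \<le> a S ^ 4 + (2 * ((a S)\<^sup>2 * (b S)\<^sup>2) + b S ^ 4)"
    proof -
      have "0 \<le> (a S)\<^sup>2 * (b S)\<^sup>2" "0 \<le> b S ^ 4" by simp_all
      then show ?thesis by linarith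
    qed
    finally show "(noise (Suc N) f S ^ 4 + noise (Suc N) f (insert N S) ^ 4) / 2
         \<le> a S ^ 4 + (2 * ((a S)\<^sup>2 * (b S)\<^sup>2) + b S ^ 4)"
      by (simp only: T[OF S])
  qed
  also have "\<dots> \<le> F\<^sup>2 + (2 * (F * G) + G\<^sup>2)"
    unfolding cube_avg_linear using A M by linarith
  also have "\<dots> = (cube_avg (Suc N) (\<lambda>S. (f S)\<^sup>2))\<^sup>2"
    unfolding L by (simp add: power2_eq_square field_simps)
  finally show ?case .
qed

text \<open>Jensen's inequality for the probability weights of the kernel, by repeated squaring:
  each square is moved inside by Cauchy-Schwarz with the kernel split into two square roots, and the
  weights sum to one.\<close>

lemma noise_power_le:
  fixes f :: "nat set \<Rightarrow> real"
  assumes "\<And>S. 0 \<le> f S"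
  shows "noise N f S ^ 2 ^ j \<le> noise N (\<lambda>S. f S ^ 2 ^ j) S"
proof (induction j)
  case (Suc j)
  let ?K = "\<lambda>S'. \<Prod>i<N. (1 + rad_sign S i * rad_sign S' i / 2) / 2"
  have sq: "(noise N g S)\<^sup>2 \<le> noise N (\<lambda>S. (g S)\<^sup>2) S" for g :: "nat set \<Rightarrow> real"
  proof -
    have "(\<Sum>S'\<in>Pow {..<N}. sqrt (?K S') * (sqrt (?K S') * g S'))\<^sup>2
      \<le> (\<Sum>S'\<in>Pow {..<N}. (sqrt (?K S'))\<^sup>2) * (\<Sum>S'\<in>Pow {..<N}. (sqrt (?K S') * g S')\<^sup>2)"
      by (rule Cauchy_Schwarz_ineq_sum)
    then show ?thesis
      unfolding noise_def power_mult_distrib mult.assoc[symmetric] real_scaleR_def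
      by (simp only: real_sqrt_mult_self real_sqrt_pow2[OF noise_kernel_nonneg]
            abs_of_nonneg[OF noise_kernel_nonneg] noise_kernel_sum mult_1_left)
  qed
  have "noise N f S ^ 2 ^ Suc j = (noise N f S ^ 2 ^ j)\<^sup>2"
    by (simp add: power_mult[symmetric] mult.commute)
  also have "\<dots> \<le> (noise N (\<lambda>S. f S ^ 2 ^ j) S)\<^sup>2"
    by (rule power_mono[OF Suc.IH]) (simp add: noise_nonneg assms)
  also have "\<dots> \<le> noise N (\<lambda>S. (f S ^ 2 ^ j)\<^sup>2) S" by (rule sq)
  finally show ?case by (simp add: power_mult[symmetric] mult.commute)
qed simp

text \<open>The L^2 to L^4 estimate for the 2^j-th power of f, after Jensen, makes T contractive
  from L^(2^(j+1)) to L^(2^(j+2)) on nonnegative functions; k such steps lead from L^2 to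
  L^(2^(k+1)).\<close>

lemma noise_power_contraction:
  fixes f :: "nat set \<Rightarrow> real"
  assumes "\<And>S. 0 \<le> f S"
  shows "cube_avg N (\<lambda>S. noise N f S ^ 2 ^ (j + 2)) \<le> (cube_avg N (\<lambda>S. f S ^ 2 ^ (j + 1)))\<^sup>2"
proof -
  have e: "a ^ 2 ^ (j + 2) = (a ^ 2 ^ j) ^ 4" "a ^ 2 ^ (j + 1) = (a ^ 2 ^ j) ^ 2" for a :: real
    by (simp_all add: power_mult[symmetric] mult.commute)
  have "cube_avg N (\<lambda>S. noise N f S ^ 2 ^ (j + 2)) \<le> cube_avg N (\<lambda>S. noise N (\<lambda>S. f S ^ 2 ^ j) S ^ 4)"
    unfolding e by (intro cube_avg_mono power_mono noise_power_le assms zero_le_power noise_nonneg)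
  also have "\<dots> \<le> (cube_avg N (\<lambda>S. (f S ^ 2 ^ j)\<^sup>2))\<^sup>2" by (rule noise_L2_L4)
  finally show ?thesis unfolding e .
qed

lemma funpow_noise_hypercontractive:
  fixes f :: "nat set \<Rightarrow> real"
  assumes "\<And>S. 0 \<le> f S"
  shows "cube_avg N (\<lambda>S. (noise N ^^ k) f S ^ 2 ^ (k + 1)) \<le> (cube_avg N (\<lambda>S. (f S)\<^sup>2)) ^ 2 ^ k"
proof (induction k)
  case (Suc k)
  have "cube_avg N (\<lambda>S. (noise N ^^ Suc k) f S ^ 2 ^ (Suc k + 1))
    \<le> (cube_avg N (\<lambda>S. (noise N ^^ k) f S ^ 2 ^ (k + 1)))\<^sup>2"
    using noise_power_contraction[of "(noise N ^^ k) f" N k] by (simp add: funpow_noise_nonneg assms)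
  also have "\<dots> \<le> ((cube_avg N (\<lambda>S. (f S)\<^sup>2)) ^ 2 ^ k)\<^sup>2"
    by (intro power_mono Suc.IH cube_avg_nonneg zero_le_power funpow_noise_nonneg assms)
  finally show ?case by (simp add: power_mult[symmetric] mult.commute)
qed simp

lemma noise_selfadjoint:
  "cube_avg N (\<lambda>S. f S * noise N g S) = cube_avg N (\<lambda>S. noise N f S * g S)"
proof -
  have "(\<Sum>S\<in>Pow {..<N}. f S * noise N g S) = (\<Sum>S\<in>Pow {..<N}. noise N f S * g S)"
    unfolding noise_def sum_distrib_left sum_distrib_right
    by (subst sum.swap) (simp add: mult_ac)
  then show ?thesis by (simp add: cube_avg_def)
qed

lemma funpow_noise_selfadjoint:
  "cube_avg N (\<lambda>S. f S * (noise N ^^ k) g S) = cube_avg N (\<lambda>S. (noise N ^^ k) f S * g S)"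
proof (induction k arbitrary: f)
  case (Suc k)
  show ?case using Suc.IH[of "noise N f"] by (simp add: noise_selfadjoint funpow_swap1[of "noise N" k f])
qed simp

section \<open>The Rademacher projection on \<open>L\<^sup>p\<close>\<close>

lemma Lp_cube_alt: "Lp_cube N p f = cube_avg N (\<lambda>S. norm (f S) powr p) powr (1 / p)"
  by (simp add: Lp_cube_def cube_avg_def)

lemma Lp_cube_nonneg: "0 \<le> Lp_cube N p f"
  by (simp add: Lp_cube_def)

lemma Lp_cube_powr:
  "p > 0 \<Longrightarrow> Lp_cube N p f powr p = cube_avg N (\<lambda>S. norm (f S) powr p)"
  by (simp add: Lp_cube_alt powr_powr cube_avg_nonneg)

lemma Lp_cube_mono:
  assumes "p > 0" "\<And>S. S \<subseteq> {..<N} \<Longrightarrow> norm (f S) \<le> norm (g S)"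
  shows "Lp_cube N p f \<le> Lp_cube N p g"
  unfolding Lp_cube_alt using assms
  by (intro powr_mono2 cube_avg_mono cube_avg_nonneg) auto

lemma Lp_cube_norm: "Lp_cube N p (\<lambda>S. norm (f S)) = Lp_cube N p f"
  by (simp add: Lp_cube_def)

lemma Lp_cube_scaleR:
  assumes "p > 0"
  shows "Lp_cube N p (\<lambda>S. c *\<^sub>R f S) = \<bar>c\<bar> * Lp_cube N p f"
  using assms by (simp add: Lp_cube_alt powr_mult cube_avg_linear cube_avg_nonneg powr_powr)

lemma Lp_cube_eq_0D:
  assumes "Lp_cube N p f = 0" "S \<subseteq> {..<N}"
  shows "f S = 0"
  using assms by (auto simp: Lp_cube_def sum_nonneg_eq_0_iff)

lemma cube_avg_Holder:
  fixes f g :: "nat set \<Rightarrow> real"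
  assumes "p > 1" "q > 1" "1 / p + 1 / q = 1" "\<And>S. 0 \<le> f S" "\<And>S. 0 \<le> g S"
  shows "cube_avg N (\<lambda>S. f S * g S) \<le> Lp_cube N p f * Lp_cube N q g"
proof (cases "Lp_cube N p f = 0 \<or> Lp_cube N q g = 0")
  case True
  then have "f S * g S = 0" if "S \<subseteq> {..<N}" for S
    using Lp_cube_eq_0D that by fastforce
  then have "cube_avg N (\<lambda>S. f S * g S) = 0" by (auto simp: cube_avg_def intro!: sum.neutral)
  then show ?thesis by (simp add: Lp_cube_nonneg)
next
  case False
  define F G where "F = Lp_cube N p f" and "G = Lp_cube N q g"
  have FG: "F > 0" "G > 0"
    using False Lp_cube_nonneg[of N p f] Lp_cube_nonneg[of N q g] by (auto simp: F_def G_def)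
  have "cube_avg N (\<lambda>S. f S * g S) = F * G * cube_avg N (\<lambda>S. (f S / F) * (g S / G))"
    using FG by (simp flip: cube_avg_linear)
  also have "cube_avg N (\<lambda>S. (f S / F) * (g S / G))
      \<le> cube_avg N (\<lambda>S. (1 / p / F powr p) * f S powr p + (1 / q / G powr q) * g S powr q)"
  proof (rule cube_avg_mono)
    fix S
    have "f S / F * (g S / G) \<le> (f S / F) powr p / p + (g S / G) powr q / q"
      using FG assms(4,5) by (intro Youngs_inequality assms(1-3)) auto
    also have "\<dots> = (1 / p / F powr p) * f S powr p + (1 / q / G powr q) * g S powr q"
      by (simp add: powr_divide mult.commute)
    finally show "f S / F * (g S / G) \<le> \<dots>" .
  qed
  also have "\<dots> = 1 / p / F powr p * F powr p + 1 / q / G powr q * G powr q"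
    unfolding cube_avg_linear using assms by (simp add: F_def G_def Lp_cube_powr)
  also have "\<dots> = 1" using FG assms(3) by simp
  finally show ?thesis using FG by (simp add: F_def G_def)
qed

lemma Lp_cube_mono_exponent:
  assumes "0 < p" "p \<le> q"
  shows "Lp_cube N p f \<le> Lp_cube N q f"
proof (cases "p = q")
  case False
  define r where "r = q / p"
  have r: "r > 1" "q > 0" using assms False by (auto simp: r_def)
  have "1 / r + 1 / (r / (r - 1)) = 1" "r / (r - 1) > 1" using r by (auto simp: field_simps)
  then have "cube_avg N (\<lambda>S. norm (f S) powr p * 1)
      \<le> Lp_cube N r (\<lambda>S. norm (f S) powr p) * Lp_cube N (r / (r - 1)) (\<lambda>_. 1 :: real)"
    using r by (intro cube_avg_Holder; simp)
  also have "Lp_cube N (r / (r - 1)) (\<lambda>_. 1 :: real) = 1"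
    by (simp add: Lp_cube_def card_Pow)
  also have "Lp_cube N r (\<lambda>S. norm (f S) powr p) = Lp_cube N q f powr p"
    using assms by (simp add: Lp_cube_alt powr_powr r_def)
  finally have "Lp_cube N p f powr p \<le> Lp_cube N q f powr p"
    using assms by (simp add: Lp_cube_powr)
  then show ?thesis
    using assms powr_mono2[of "1/p" "Lp_cube N p f powr p" "Lp_cube N q f powr p"]
    by (simp add: powr_powr Lp_cube_nonneg)
qed simp

lemma Lp_cube_powr_nat:
  "n > 0 \<Longrightarrow> Lp_cube N (real n) f ^ n = cube_avg N (\<lambda>S. norm (f S) ^ n)"
  using Lp_cube_powr[of "real n" N f] by (simp add: powr_realpow' Lp_cube_nonneg)

section \<open>Transfer of the boundedness of R from L^2 to L^p\<close>

lemma funpow_noise_L2_Lq: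
  "Lp_cube N (2 ^ (k + 1)) ((noise N ^^ k) f) \<le> Lp_cube N 2 f"
proof -
  let ?n = "2 ^ (k + 1) :: nat" and ?u = "\<lambda>S. norm (f S)"
  have "Lp_cube N (real ?n) ((noise N ^^ k) ?u) ^ ?n \<le> (Lp_cube N 2 ?u ^ 2) ^ 2 ^ k"
    using funpow_noise_hypercontractive[of ?u N k]
      Lp_cube_powr_nat[of 2 N ?u] Lp_cube_powr_nat[of ?n N "(noise N ^^ k) ?u"]
    by (simp add: power_abs[symmetric] abs_of_nonneg[OF funpow_noise_nonneg] del: power_Suc)
  then have "Lp_cube N (real ?n) ((noise N ^^ k) ?u) ^ ?n \<le> Lp_cube N 2 ?u ^ ?n"
    by (simp add: power_mult[symmetric])
  then have "Lp_cube N (real ?n) ((noise N ^^ k) ?u) \<le> Lp_cube N 2 ?u"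
    by (subst (asm) power_mono_iff) (simp_all add: Lp_cube_nonneg)
  moreover have "Lp_cube N (real ?n) ((noise N ^^ k) f) \<le> Lp_cube N (real ?n) ((noise N ^^ k) ?u)"
    using norm_funpow_noise_le[of k N f]
    by (intro Lp_cube_mono) (auto simp: abs_of_nonneg[OF funpow_noise_nonneg])
  ultimately show ?thesis by (simp add: Lp_cube_norm)
qed

text \<open>Duality without a dual space. With u the norm of f, g = T^k u and q = 2^(k+1),
  selfadjointness gives ||g||_2^2 = <u, T^k g>, which Hoelder and the estimate from L^2 to L^q bound
  by ||u||_p ||g||_2; one factor ||g||_2 cancels.\<close>

lemma funpow_noise_Lq_dual_L2:
  assumes "k \<ge> 1" "1 / p + 1 / 2 ^ (k + 1) = 1"
  shows "Lp_cube N 2 ((noise N ^^ k) f) \<le> Lp_cube N p f"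
proof -
  let ?u = "\<lambda>S. norm (f S)"
  let ?g = "(noise N ^^ k) ?u"
  have g0: "0 \<le> ?g S" "0 \<le> (noise N ^^ k) ?g S" for S by (simp_all add: funpow_noise_nonneg)
  have q: "(2::real) ^ (k + 1) > 1" by (rule one_less_power) auto
  then have "1 / (2::real) ^ (k + 1) < 1" "1 / (2::real) ^ (k + 1) > 0" by simp_all
  then have "1 / p < 1" "1 / p > 0" using assms(2) by linarith+
  then have p: "p > 1" by (simp add: divide_less_eq zero_less_divide_iff)
  have "Lp_cube N 2 ?g ^ 2 = cube_avg N (\<lambda>S. ?g S * ?g S)"
    using Lp_cube_powr_nat[of 2 N ?g] by (simp add: power2_eq_square)
  also have "\<dots> = cube_avg N (\<lambda>S. ?u S * (noise N ^^ k) ?g S)"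
    by (rule funpow_noise_selfadjoint[symmetric])
  also have "\<dots> \<le> Lp_cube N p ?u * Lp_cube N (2 ^ (k + 1)) ((noise N ^^ k) ?g)"
    using p q assms(2) g0 by (intro cube_avg_Holder) auto
  also have "\<dots> \<le> Lp_cube N p ?u * Lp_cube N 2 ?g"
    by (intro mult_left_mono funpow_noise_L2_Lq Lp_cube_nonneg)
  finally have "Lp_cube N 2 ?g * Lp_cube N 2 ?g \<le> Lp_cube N p ?u * Lp_cube N 2 ?g"
    by (simp add: power2_eq_square)
  then have "Lp_cube N 2 ?g \<le> Lp_cube N p ?u"
    using Lp_cube_nonneg[of N 2 ?g] Lp_cube_nonneg[of N p ?u] by (auto simp: mult_le_cancel_right)
  moreover have "Lp_cube N 2 ((noise N ^^ k) f) \<le> Lp_cube N 2 ?g"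
    using norm_funpow_noise_le[of k N f] g0 by (intro Lp_cube_mono) auto
  ultimately show ?thesis by (simp add: Lp_cube_norm)
qed

text \<open>Undoing T^k by 2^k on the range of R gives R f = 4^k T^k R T^k f. The inner T^k maps
  L^q' to L^2, R acts on L^2, and the outer T^k maps L^2 to L^q. As q' \<le> p \<le> q, monotonicity
  of the norms in the exponent closes the chain.\<close>

lemma K_convex_imp_rad_proj_Lp_bound:
  assumes "K_convex TYPE('a::real_normed_vector)" "1 < p"
  obtains B where "\<And>N (x :: nat set \<Rightarrow> 'a). Lp_cube N p (rad_proj N x) \<le> B * Lp_cube N p (walsh N x)"
proof -
  obtain C0 where C0: "\<And>N (x :: nat set \<Rightarrow> 'a). Lp_cube N 2 (rad_proj N x) \<le> C0 * Lp_cube N 2 (walsh N x)"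
    using assms(1) unfolding K_convex_def by blast
  \<comment> \<open>The constant in \<open>K_convex\<close> may be negative, while the estimates
    below multiply inequalities by it.\<close>
  define C where "C = \<bar>C0\<bar>"
  have C: "Lp_cube N 2 (rad_proj N x) \<le> C * Lp_cube N 2 (walsh N x)" "C \<ge> 0" for N and x :: "nat set \<Rightarrow> 'a"
    using C0[of N x] mult_right_mono[OF abs_ge_self[of C0] Lp_cube_nonneg[of N 2 "walsh N x"]] by (auto simp: C_def)
  \<comment> \<open>The maximum makes q exceed both p and its conjugate exponent; the latter is what
    gives q' \<le> p.\<close>
  define t where "t = max p (p / (p - 1))"
  obtain k0 where k0: "t < 2 ^ k0" using real_arch_pow[of 2 t] by auto
  define k where "k = Suc k0"
  define q :: real where "q = 2 ^ (k + 1)"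
  have "(2::real) ^ k0 \<le> q" unfolding q_def k_def by (rule power_increasing) auto
  with k0 have q: "p < q" "p / (p - 1) < q" by (auto simp: t_def)
  define q' where "q' = q / (q - 1)"
  have q': "0 < q'" "q' \<le> p" "1 / q' + 1 / q = 1"
    using q assms(2) by (auto simp: q'_def field_simps)
  have "Lp_cube N p (rad_proj N x) \<le> (4 ^ k * C) * Lp_cube N p (walsh N x)" for N and x :: "nat set \<Rightarrow> 'a"
  proof -
    let ?x = "\<lambda>A. ((1/2) ^ card A) ^ k *\<^sub>R x A"
    have "Lp_cube N p (rad_proj N x) \<le> Lp_cube N q (rad_proj N x)"
      using q assms by (intro Lp_cube_mono_exponent) auto
    also have "Lp_cube N q (rad_proj N x) = 2 ^ k * Lp_cube N q ((noise N ^^ k) (rad_proj N x))"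
      unfolding funpow_noise_rad_proj[abs_def] using q assms
      by (subst Lp_cube_scaleR) (auto simp: power_one_over)
    also have "\<dots> \<le> 2 ^ k * Lp_cube N 2 (rad_proj N x)"
      unfolding q_def by (intro mult_left_mono funpow_noise_L2_Lq) auto
    also have "Lp_cube N 2 (rad_proj N x) = Lp_cube N 2 (\<lambda>S. 2 ^ k *\<^sub>R rad_proj N ?x S)"
      by (intro arg_cong[where f = "Lp_cube N 2"] ext)
        (simp add: rad_proj_def scaleR_sum_right power_one_over)
    also have "\<dots> = 2 ^ k * Lp_cube N 2 (rad_proj N ?x)"
      by (subst Lp_cube_scaleR) auto
    also have "2 ^ k * (2 ^ k * Lp_cube N 2 (rad_proj N ?x)) = 4 ^ k * Lp_cube N 2 (rad_proj N ?x)"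
      by (simp flip: power_mult_distrib mult.assoc)
    also have "\<dots> \<le> 4 ^ k * (C * Lp_cube N 2 (walsh N ?x))"
      by (intro mult_left_mono C) auto
    also have "walsh N ?x = (noise N ^^ k) (walsh N x)" by (rule funpow_noise_walsh[symmetric])
    also have "4 ^ k * (C * Lp_cube N 2 \<dots>) \<le> 4 ^ k * (C * Lp_cube N q' (walsh N x))"
      using q' by (intro mult_left_mono funpow_noise_Lq_dual_L2 C) (auto simp: q_def k_def)
    also have "\<dots> \<le> 4 ^ k * (C * Lp_cube N p (walsh N x))"
      using q' by (intro mult_left_mono Lp_cube_mono_exponent C) auto
    finally show ?thesis by (simp add: mult.assoc)
  qed
  then show ?thesis using that by blast
qed

text \<open>The bound B makes the set of quotients bounded above, so the supremum is a true upper
  bound. A Walsh polynomial of norm zero contributes no quotient; there B forces its projection to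
  have norm zero too.\<close>

lemma rad_proj_le_K_const:
  fixes x :: "nat set \<Rightarrow> 'a::real_normed_vector"
  assumes "K_convex TYPE('a)" "1 < p"
  shows "Lp_cube N p (rad_proj N x) \<le> K_const p TYPE('a) * Lp_cube N p (walsh N x)"
proof -
  obtain B where B: "\<And>N (x :: nat set \<Rightarrow> 'a). Lp_cube N p (rad_proj N x) \<le> B * Lp_cube N p (walsh N x)"
    using K_convex_imp_rad_proj_Lp_bound[OF assms] by metis
  show ?thesis
  proof (cases "Lp_cube N p (walsh N x) = 0")
    case True
    then show ?thesis using B[of N x] by simp
  next
    case False
    then have pos: "Lp_cube N p (walsh N x) > 0" using Lp_cube_nonneg[of N p "walsh N x"] by linarith
    have "Lp_cube N p (rad_proj N x) / Lp_cube N p (walsh N x) \<le> K_const p TYPE('a)"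
      unfolding K_const_def
    proof (rule cSup_upper)
      show "bdd_above {Lp_cube N p (rad_proj N x) / Lp_cube N p (walsh N x) | N (x :: nat set \<Rightarrow> 'a).
          Lp_cube N p (walsh N x) \<noteq> 0}"
      proof (rule bdd_aboveI[of _ B], clarify)
        fix N and x :: "nat set \<Rightarrow> 'a" assume "Lp_cube N p (walsh N x) \<noteq> 0"
        then have "Lp_cube N p (walsh N x) > 0" using Lp_cube_nonneg[of N p "walsh N x"] by linarith
        then show "Lp_cube N p (rad_proj N x) / Lp_cube N p (walsh N x) \<le> B"
          using B[of N x] by (simp add: divide_le_eq)
      qed
    qed (use False in blast)
    then show ?thesis using pos by (simp add: divide_le_eq)
  qed
qed

text \<open>A nonzero constant in no variables has positive norm, so the estimate for R itself
  forces the sign. In the zero space there is no quotient at all, and the supremum of the empty set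
  says nothing.\<close>

lemma K_const_nonneg:
  assumes "K_convex TYPE('a::real_normed_vector)" "1 < p" "(a :: 'a) \<noteq> 0"
  shows "0 \<le> K_const p TYPE('a)"
proof -
  let ?x = "\<lambda>A. if A = {} then a else 0"
  have "walsh 0 ?x {} = a" by (simp add: walsh_def)
  then have "Lp_cube 0 p (walsh 0 ?x) \<noteq> 0" using assms(3) Lp_cube_eq_0D[of 0 p "walsh 0 ?x" "{}"] by auto
  then have "Lp_cube 0 p (walsh 0 ?x) > 0" using Lp_cube_nonneg[of 0 p "walsh 0 ?x"] by linarith
  moreover have "0 \<le> K_const p TYPE('a) * Lp_cube 0 p (walsh 0 ?x)"
    by (rule order_trans[OF Lp_cube_nonneg rad_proj_le_K_const[OF assms(1,2)]])
  ultimately show ?thesis by (simp add: zero_le_mult_iff)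
qed

section \<open>Steinhaus variables and the contraction principle\<close>

lemma cis_measurable [measurable]: "cis \<in> borel_measurable borel"
  by (intro borel_measurable_continuous_onI continuous_intros)

lemma prob_space_steinhaus: "prob_space steinhaus"
  unfolding steinhaus_def
  by (intro prob_space.prob_space_distr prob_space_uniform_measure) (simp_all, measurable)

lemma sets_steinhaus [simp, measurable_cong]: "sets steinhaus = sets borel"
  and space_steinhaus [simp]: "space steinhaus = UNIV"
  by (simp_all add: steinhaus_def)

lemma AE_steinhaus: "AE z in steinhaus. cmod z = 1"
  unfolding steinhaus_def by (subst AE_distr_iff) auto

text \<open>The left endpoint is a null set. Without it the interval covers the circle exactly once,
  so that translated periods can be cut and glued without overlap.\<close>

lemma emeasure_steinhaus:
  assumes "A \<in> sets borel"
  shows "emeasure steinhaus A = emeasure lborel ({0<..2*pi} \<inter> cis -` A) / ennreal (2 * pi)"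
proof -
  have m: "cis -` A \<in> sets borel" using measurable_sets[OF cis_measurable assms] by simp
  have "emeasure steinhaus A = emeasure lborel ({0..2*pi} \<inter> cis -` A) / ennreal (2 * pi)"
    using assms m by (simp add: steinhaus_def emeasure_distr)
  also have "emeasure lborel ({0..2*pi} \<inter> cis -` A) = emeasure lborel ({0<..2*pi} \<inter> cis -` A)"
    by (rule emeasure_eq_AE)
      (use m AE_lborel_singleton[of 0] in \<open>auto elim!: eventually_mono\<close>)
  finally show ?thesis .
qed

lemma emeasure_lborel_translate:
  assumes "S \<in> sets borel"
  shows "emeasure lborel ((+) c -` S) = emeasure lborel (S :: real set)"
  using emeasure_distr[of "(+) c" lborel borel S] assms by (simp add: lborel_distr_plus)

text \<open>Rotation by \<open>cis t\<close> translates the angle by t. The part of the translated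
  period that lies beyond 2 pi is moved back by one period.\<close>

lemma steinhaus_rotate:
  assumes "cmod z = 1"
  shows "distr steinhaus borel ((*) z) = steinhaus"
proof (rule measure_eqI)
  fix A assume "A \<in> sets (distr steinhaus borel ((*) z))"
  then have A: "A \<in> sets borel" by simp
  obtain t where t: "0 \<le> t" "t < 2 * pi" "z = cis t"
    by (metis Arg2pi_eq assms Arg2pi_ge_0 Arg2pi_lt_2pi cis_conv_exp mult_1 of_real_1)
  define B where "B = cis -` A"
  have B[measurable]: "B \<in> sets borel"
    unfolding B_def using measurable_sets[OF cis_measurable A] by simp
  let ?e = "emeasure (lborel :: real measure)"
  have per: "2 * pi + \<theta> \<in> B \<longleftrightarrow> \<theta> \<in> B" for \<theta>
    by (simp add: B_def flip: cis_mult)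
  have "?e ({0<..2*pi} \<inter> (+) t -` B) = ?e ((+) t -` ({t<..t+2*pi} \<inter> B))"
    by (rule arg_cong[where f = ?e]) auto
  also have "\<dots> = ?e ({t<..t+2*pi} \<inter> B)"
    by (rule emeasure_lborel_translate) auto
  also have "\<dots> = ?e (({t<..2*pi} \<inter> B) \<union> ({2*pi<..t+2*pi} \<inter> B))"
    using t by (intro arg_cong[where f = ?e]) auto
  also have "\<dots> = ?e ({t<..2*pi} \<inter> B) + ?e ({2*pi<..t+2*pi} \<inter> B)"
    by (rule plus_emeasure[symmetric]) auto
  also have "?e ({2*pi<..t+2*pi} \<inter> B) = ?e ((+) (2*pi) -` ({2*pi<..t+2*pi} \<inter> B))"
    by (rule emeasure_lborel_translate[symmetric]) auto
  also have "(+) (2*pi) -` ({2*pi<..t+2*pi} \<inter> B) = {0<..t} \<inter> B"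
    using per by auto
  also have "?e ({t<..2*pi} \<inter> B) + ?e ({0<..t} \<inter> B) = ?e (({t<..2*pi} \<inter> B) \<union> ({0<..t} \<inter> B))"
    by (rule plus_emeasure) auto
  also have "({t<..2*pi} \<inter> B) \<union> ({0<..t} \<inter> B) = {0<..2*pi} \<inter> B"
    using t by auto
  finally have *: "?e ({0<..2*pi} \<inter> (+) t -` B) = ?e ({0<..2*pi} \<inter> B)" .
  have m: "(*) z \<in> borel_measurable borel" by measurable
  have zA: "(*) z -` A \<in> sets borel" using measurable_sets[OF m A] by simp
  have "cis -` (*) z -` A = (+) t -` B" by (auto simp: B_def t cis_mult)
  then show "emeasure (distr steinhaus borel ((*) z)) A = emeasure steinhaus A"
    using * A zA by (subst emeasure_distr) (simp_all add: emeasure_steinhaus B_def)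
qed simp

text \<open>Passes to a Henstock-Kurzweil integral over one period, where antiderivatives can be
  used; the bound on f supplies the Lebesgue integrability for the change of integral.\<close>

lemma integral_steinhaus:
  fixes f :: "complex \<Rightarrow> complex"
  assumes [measurable]: "f \<in> borel_measurable borel" and bound: "\<And>u. cmod (f u) \<le> B"
  shows "(\<integral>u. f u \<partial>steinhaus) = integral {0..2*pi} (\<lambda>t. f (cis t)) / (2 * pi)"
proof -
  have U: "uniform_measure lborel {0..2*pi} = density lborel (\<lambda>t. ennreal (indicator {0..2*pi} t / (2 * pi)))"
    unfolding uniform_measure_def
    by (intro arg_cong2[where f = density] ext refl)
      (auto simp: indicator_def divide_ennreal simp flip: ennreal_1 split: if_splits)
  have si: "set_integrable lborel {0..2*pi} (\<lambda>t. f (cis t))"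
    unfolding set_integrable_def
  proof (rule Bochner_Integration.integrable_bound)
    show "integrable lborel (\<lambda>t. indicator {0..2*pi} t *\<^sub>R B)" by simp
    show "AE t in lborel. norm (indicator {0..2*pi} t *\<^sub>R f (cis t)) \<le> norm (indicator {0..2*pi} t *\<^sub>R B)"
      using order_trans[OF bound abs_ge_self] by (auto simp: indicator_def)
  qed measurable
  have "(\<integral>u. f u \<partial>steinhaus) = (\<integral>t. f (cis t) \<partial>uniform_measure lborel {0..2*pi})"
    unfolding steinhaus_def by (subst integral_distr) auto
  also have "\<dots> = (\<integral>t. (indicator {0..2*pi} t / (2 * pi)) *\<^sub>R f (cis t) \<partial>lborel)"
    unfolding U by (subst integral_density) auto
  also have "\<dots> = (\<integral>t. (1 / (2 * pi)) *\<^sub>R (indicator {0..2*pi} t *\<^sub>R f (cis t)) \<partial>lborel)"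
    by (simp add: mult.commute)
  also have "\<dots> = (1 / (2 * pi)) *\<^sub>R (LINT t : {0..2*pi} | lborel. f (cis t))"
    unfolding set_lebesgue_integral_def by (rule integral_scaleR_right)
  also have "(LINT t : {0..2*pi} | lborel. f (cis t)) = integral {0..2*pi} (\<lambda>t. f (cis t))"
    by (rule set_borel_integral_eq_integral(2)[OF si])
  finally show ?thesis by (simp add: scaleR_conv_of_real)
qed

text \<open>The real part is the mean of |cos t| over a period, and the imaginary part cancels. The
  reciprocal of this value is the contraction constant pi/2.\<close>

lemma integral_steinhaus_sgn_Re:
  "(\<integral>u. u * (if Re u < 0 then -1 else 1) \<partial>steinhaus) = 2 / pi"
proof -
  let ?f = "\<lambda>t. cis t * (if cos t < 0 then -1 else 1)"
  \<comment> \<open>The sign of the cosine is constant between its zeros, so the period is cut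
    there; on each piece -i \<open>cis t\<close> times the sign is an antiderivative.\<close>
  have D: "(?f has_integral ((- \<i> * cis b) * e - (- \<i> * cis a) * e)) {a..b}"
    if "a \<le> b" "\<And>t. t \<in> {a<..<b} \<Longrightarrow> (if cos t < 0 then -1 else 1) = e" for a b and e :: complex
  proof (rule fundamental_theorem_of_calculus_interior)
    fix t assume "t \<in> {a<..<b}"
    then have *: "?f t = cis t * e" by (simp only: that(2))
    show "((\<lambda>t. - \<i> * cis t * e) has_vector_derivative ?f t) (at t)"
      unfolding *
      by (auto simp: has_vector_derivative_def fun_eq_iff scaleR_conv_of_real algebra_simps intro!: derivative_eq_intros)
  qed (use that in \<open>auto intro!: continuous_intros\<close>)
  have c1: "(if cos t < 0 then -1 else 1) = (1::complex)" if "t \<in> {0<..<pi/2}" for t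
    using cos_gt_zero[of t] that by auto
  have c2: "(if cos t < 0 then -1 else 1) = (-1::complex)" if "t \<in> {pi/2<..<3*pi/2}" for t
    using cos_gt_zero_pi[of "t - pi"] that by (auto simp: cos_diff)
  have c3: "(if cos t < 0 then -1 else 1) = (1::complex)" if "t \<in> {3*pi/2<..<2*pi}" for t
    using cos_gt_zero_pi[of "t - 2*pi"] that by (auto simp: cos_diff)
  have 32: "cis (3 * pi / 2) = - \<i>"
    using cis_mult[of pi "pi/2"] by (simp add: field_simps)
  have "(?f has_integral (4::complex)) {0..2*pi}"
    using has_integral_combine[OF _ _ has_integral_combine[OF _ _
          D[of 0 "pi/2", OF _ c1] D[of "pi/2" "3*pi/2", OF _ c2]] D[of "3*pi/2" "2*pi", OF _ c3]]
    by (simp add: 32)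
  then have "integral {0..2*pi} ?f = 4" by (rule integral_unique)
  moreover have "(\<integral>u. u * (if Re u < 0 then -1 else 1) \<partial>steinhaus) = integral {0..2*pi} ?f / (2 * pi)"
  proof -
    \<comment> \<open>\<open>sgn u\<close> agrees with u on the unit circle and is bounded
      everywhere, as \<open>integral_steinhaus\<close> requires.\<close>
    let ?g = "\<lambda>u. sgn u * (if Re u < 0 then -1 else 1) :: complex"
    have "(\<integral>u. u * (if Re u < 0 then -1 else 1) \<partial>steinhaus) = (\<integral>u. ?g u \<partial>steinhaus)"
      by (rule integral_cong_AE) (use AE_steinhaus in \<open>auto simp: sgn_div_norm elim!: eventually_mono\<close>)
    also have "\<dots> = integral {0..2*pi} (\<lambda>t. ?g (cis t)) / (2 * pi)"
      by (rule integral_steinhaus[where B = 1]) (auto simp: norm_mult norm_sgn)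
    finally show ?thesis by simp
  qed
  ultimately show ?thesis by simp
qed

section \<open>From signs to unimodular multipliers\<close>

lemma integral_steinhaus_sgn_Re_cnj:
  assumes "cmod z = 1"
  shows "(\<integral>u. u * (if Re (z * cnj u) < 0 then -1 else 1) \<partial>steinhaus) = z * (2 / pi)"
proof -
  \<comment> \<open>By this identity the rotation of u to z u turns Re (z cnj u) into Re u.\<close>
  have zz: "z * cnj z = 1" using assms by (simp add: complex_mult_cnj cmod_def)
  have "(\<integral>u. u * (if Re (z * cnj u) < 0 then -1 else 1) \<partial>steinhaus)
    = (\<integral>u. u * (if Re (z * cnj u) < 0 then -1 else 1) \<partial>distr steinhaus borel ((*) z))"
    by (simp add: steinhaus_rotate assms)
  also have "\<dots> = (\<integral>u. z * (u * (if Re u < 0 then -1 else 1)) \<partial>steinhaus)"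
    using zz by (subst integral_distr) (auto simp: mult.assoc[symmetric])
  also have "\<dots> = z * (2 / pi)"
    by (simp only: integral_mult_right_zero integral_steinhaus_sgn_Re)
  finally show ?thesis .
qed

text \<open>Each z_k is pi/2 times the mean of u sgn (Re (z_k cnj u)), where only the sign depends
  on k. Grouping the u by the finitely many patterns of these signs gives the combination, and its
  weights add up to at most pi/2 times the mean of |u|, which is 1.\<close>

lemma unimodular_sign_decomposition:
  assumes "\<And>k. k < N \<Longrightarrow> cmod (z k) = 1"
  obtains c :: "nat set \<Rightarrow> complex"
  where "\<And>k. k < N \<Longrightarrow> z k = (\<Sum>S\<in>Pow {..<N}. c S * rad_sign S k)"
    and "(\<Sum>S\<in>Pow {..<N}. cmod (c S)) \<le> pi / 2"
proof -
  interpret prob_space steinhaus by (rule prob_space_steinhaus)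
  define pat where "pat u = {k \<in> {..<N}. Re (z k * cnj u) < 0}" for u
  have pat_meas [measurable]: "{u. pat u = S} \<in> sets borel" for S
  proof -
    have Re_neg: "{u. Re (z k * cnj u) < 0} \<in> sets borel" for k
      by (intro borel_open open_Collect_less continuous_intros)
    have "{u \<in> space borel. Re (z k * cnj u) < 0 \<longleftrightarrow> k \<in> S} \<in> sets borel" for k
      using Re_neg[of k] borel_comp[OF Re_neg[of k]] by (cases "k \<in> S") (simp_all add: Compl_eq)
    then have "{u \<in> space borel. \<forall>k\<in>{..<N}. Re (z k * cnj u) < 0 \<longleftrightarrow> k \<in> S} \<in> sets borel"
      by (cases "{..<N} = {}") (simp, intro sets.sets_Collect_finite_All', auto)
    moreover have "{u. pat u = S} = (if S \<subseteq> {..<N}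
        then {u \<in> space borel. \<forall>k\<in>{..<N}. Re (z k * cnj u) < 0 \<longleftrightarrow> k \<in> S} else {})"
      by (auto simp: pat_def)
    ultimately show ?thesis by simp
  qed
  have pat_Pow: "pat u \<in> Pow {..<N}" for u by (auto simp: pat_def)
  have int: "integrable steinhaus (\<lambda>u. indicator {u. pat u = S} u *\<^sub>R u)" for S
  proof (rule integrable_const_bound[where B = 1])
    show "AE u in steinhaus. norm (indicator {u. pat u = S} u *\<^sub>R u) \<le> 1"
      using AE_steinhaus by (auto simp: indicator_def elim!: eventually_mono)
  qed measurable
  define c where "c S = (pi / 2) *\<^sub>R (\<integral>u. indicator {u. pat u = S} u *\<^sub>R u \<partial>steinhaus)" for S
  have "z k = (\<Sum>S\<in>Pow {..<N}. c S * rad_sign S k)" if k: "k < N" for k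
  proof -
    have "(\<Sum>S\<in>Pow {..<N}. c S * rad_sign S k)
      = (pi / 2) *\<^sub>R (\<Sum>S\<in>Pow {..<N}. (\<integral>u. rad_sign S k *\<^sub>R (indicator {u. pat u = S} u *\<^sub>R u) \<partial>steinhaus))"
      unfolding scaleR_sum_right integral_scaleR_right c_def
      by (intro sum.cong refl) (simp add: scaleR_conv_of_real mult_ac)
    also have "(\<Sum>S\<in>Pow {..<N}. (\<integral>u. rad_sign S k *\<^sub>R (indicator {u. pat u = S} u *\<^sub>R u) \<partial>steinhaus))
      = (\<integral>u. (\<Sum>S\<in>Pow {..<N}. rad_sign S k *\<^sub>R (indicator {u. pat u = S} u *\<^sub>R u)) \<partial>steinhaus)"
      by (rule Bochner_Integration.integral_sum[symmetric]) (rule integrable_scaleR_right, rule int)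
    also have "\<dots> = (\<integral>u. u * (if Re (z k * cnj u) < 0 then -1 else 1) \<partial>steinhaus)"
    proof (rule Bochner_Integration.integral_cong[OF refl])
      fix u
      have "(\<Sum>S\<in>Pow {..<N}. rad_sign S k *\<^sub>R (indicator {u. pat u = S} u *\<^sub>R u))
        = (\<Sum>S\<in>Pow {..<N}. if S = pat u then rad_sign S k *\<^sub>R u else 0)"
        by (intro sum.cong) (auto simp: indicator_def)
      also have "\<dots> = rad_sign (pat u) k *\<^sub>R u"
        using pat_Pow[of u] by (subst sum.delta) simp_all
      also have "\<dots> = u * (if Re (z k * cnj u) < 0 then -1 else 1)"
        using k by (simp add: rad_sign_def pat_def)
      finally show "(\<Sum>S\<in>Pow {..<N}. rad_sign S k *\<^sub>R (indicator {u. pat u = S} u *\<^sub>R u))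
        = u * (if Re (z k * cnj u) < 0 then -1 else 1)" .
    qed
    also have "(pi / 2) *\<^sub>R \<dots> = z k"
      unfolding integral_steinhaus_sgn_Re_cnj[OF assms[OF k]] by (simp add: scaleR_conv_of_real)
    finally show ?thesis ..
  qed
  moreover have "(\<Sum>S\<in>Pow {..<N}. cmod (c S)) \<le> pi / 2"
  proof -
    have "cmod (c S) \<le> pi / 2 * (\<integral>u. indicator {u. pat u = S} u \<partial>steinhaus)" for S
    proof -
      have "cmod (\<integral>u. indicator {u. pat u = S} u *\<^sub>R u \<partial>steinhaus)
        \<le> (\<integral>u. norm (indicator {u. pat u = S} u *\<^sub>R u) \<partial>steinhaus)"
        by (rule integral_norm_bound)
      also have "\<dots> = (\<integral>u. indicator {u. pat u = S} u \<partial>steinhaus)"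
      proof (rule integral_cong_AE)
        show "AE u in steinhaus. norm (indicator {u. pat u = S} u *\<^sub>R u) = indicator {u. pat u = S} u"
          using AE_steinhaus by (auto simp: indicator_def elim!: eventually_mono)
      qed measurable
      finally show ?thesis by (simp add: c_def mult_left_mono)
    qed
    then have "(\<Sum>S\<in>Pow {..<N}. cmod (c S))
      \<le> pi / 2 * (\<Sum>S\<in>Pow {..<N}. \<integral>u. indicator {u. pat u = S} u \<partial>steinhaus)"
      unfolding sum_distrib_left by (rule sum_mono)
    also have "(\<Sum>S\<in>Pow {..<N}. \<integral>u. indicator {u. pat u = S} u \<partial>steinhaus)
      = (\<integral>u. (\<Sum>S\<in>Pow {..<N}. indicator {u. pat u = S} u) \<partial>steinhaus :: real)"
    proof (rule Bochner_Integration.integral_sum[symmetric], rule integrable_const_bound[where B = 1])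
      show "AE u in steinhaus. norm (indicator {u. pat u = S} u :: real) \<le> 1" for S
        by (simp add: indicator_def)
    qed measurable
    also have "\<dots> = (\<integral>u. 1 \<partial>steinhaus)"
      using pat_Pow by (intro Bochner_Integration.integral_cong) (auto simp: indicator_def)
    also have "\<dots> = 1" using prob_space by simp
    finally show ?thesis by simp
  qed
  ultimately show ?thesis using that by blast
qed

text \<open>Convexity of t^p for weights that need not sum to one, whence the power p - 1 of their
  total. Young's inequality serves as the tangent line at the weighted mean s.\<close>

lemma weighted_power_mean:
  fixes c t :: "'i \<Rightarrow> real"
  assumes "\<And>i. i \<in> I \<Longrightarrow> 0 \<le> c i" "\<And>i. i \<in> I \<Longrightarrow> 0 \<le> t i" "1 \<le> p"
  shows "(\<Sum>i\<in>I. c i * t i) powr p \<le> (\<Sum>i\<in>I. c i) powr (p - 1) * (\<Sum>i\<in>I. c i * t i powr p)"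
proof -
  define C where "C = (\<Sum>i\<in>I. c i)"
  define s where "s = (\<Sum>i\<in>I. c i * t i) / C"
  have nn: "0 \<le> C" "0 \<le> (\<Sum>i\<in>I. c i * t i)" "0 \<le> (\<Sum>i\<in>I. c i * t i powr p)"
    using assms by (auto simp: C_def intro!: sum_nonneg)
  have z: "(\<Sum>i\<in>I. c i * t i) = 0" if "C = 0"
  proof (cases "finite I")
    case True
    then have "\<forall>i\<in>I. c i = 0" using that assms(1) by (simp add: C_def sum_nonneg_eq_0_iff)
    then show ?thesis by simp
  qed simp
  show ?thesis
  proof (cases "(\<Sum>i\<in>I. c i * t i) = 0 \<or> p = 1")
    case True
    then show ?thesis
      using z nn assms by (auto simp: C_def[symmetric] intro!: sum_mono mult_left_mono)
  next
    case False
    then have p: "p > 1" and C: "C > 0" and s: "s > 0"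
      using z nn assms(3) by (auto simp: s_def less_le)
    have Cs: "C * s = (\<Sum>i\<in>I. c i * t i)" using C by (simp add: s_def)
    have sp: "s * s powr (p - 1) = s powr p" using s by (simp add: powr_mult_base)
    have young: "p * (t i * s powr (p - 1)) \<le> t i powr p + (p - 1) * s powr p" if "i \<in> I" for i
    proof -
      have "t i * s powr (p - 1) \<le> t i powr p / p + (s powr (p - 1)) powr (p / (p - 1)) / (p / (p - 1))"
        using p assms(2)[OF that] by (intro Youngs_inequality) (auto simp: field_simps)
      also have "(s powr (p - 1)) powr (p / (p - 1)) = s powr p"
        using p by (simp add: powr_powr)
      finally show ?thesis using p by (simp add: field_simps)
    qed
    have "p * (C * s powr p) = p * ((\<Sum>i\<in>I. c i * t i) * s powr (p - 1))"
      using Cs by (simp only: sp[symmetric] mult.assoc[symmetric])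
    also have "\<dots> = (\<Sum>i\<in>I. c i * (p * (t i * s powr (p - 1))))"
      by (simp add: sum_distrib_left sum_distrib_right mult_ac)
    also have "\<dots> \<le> (\<Sum>i\<in>I. c i * (t i powr p + (p - 1) * s powr p))"
      by (intro sum_mono mult_left_mono young assms)
    also have "\<dots> = (\<Sum>i\<in>I. c i * t i powr p) + (p - 1) * (C * s powr p)"
      by (simp add: distrib_left sum.distrib C_def sum_distrib_left sum_distrib_right mult_ac)
    finally have *: "C * s powr p \<le> (\<Sum>i\<in>I. c i * t i powr p)" by (simp add: algebra_simps)
    have "(\<Sum>i\<in>I. c i * t i) powr p = (C * s) powr p" using C by (simp add: s_def)
    also have "\<dots> = C powr (p - 1) * (C * s powr p)"
      using C by (simp add: powr_mult powr_mult_base mult.assoc[symmetric] mult.commute[of _ C])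
    also have "\<dots> \<le> C powr (p - 1) * (\<Sum>i\<in>I. c i * t i powr p)"
      by (rule mult_left_mono[OF *]) simp
    finally show ?thesis by (simp add: C_def)
  qed
qed

lemma scaleC_sum_left: "sum f I *\<^sub>C (b :: 'a::complex_normed_vector) = (\<Sum>i\<in>I. f i *\<^sub>C b)"
proof -
  interpret additive "\<lambda>z. z *\<^sub>C b" by standard (rule scaleC_add_left)
  show ?thesis by (rule sum)
qed

lemma scaleC_sum_right: "z *\<^sub>C sum f I = (\<Sum>i\<in>I. z *\<^sub>C (f i :: 'a::complex_normed_vector))"
proof -
  interpret additive "\<lambda>b :: 'a. z *\<^sub>C b" by standard (rule scaleC_add_right)
  show ?thesis by (rule sum)
qed

lemma cube_avg_sum:
  "cube_avg N (\<lambda>S. \<Sum>i\<in>I. c i * f i S) = (\<Sum>i\<in>I. c i * cube_avg N (f i))"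
proof -
  have "(\<Sum>S\<in>Pow {..<N}. \<Sum>i\<in>I. c i * f i S) = (\<Sum>i\<in>I. c i * (\<Sum>S\<in>Pow {..<N}. f i S))"
    by (subst sum.swap) (simp only: sum_distrib_left)
  then show ?thesis
    unfolding cube_avg_def by (simp only: sum_divide_distrib[of _ I] times_divide_eq_right)
qed

text \<open>In the set encoding of the cube, symmetric difference is coordinatewise multiplication
  of signs, so multiplying by a fixed sign pattern becomes a bijection of the cube.\<close>

lemma rad_sign_sym_diff: "rad_sign (sym_diff S U) k = rad_sign S k * rad_sign U k"
  by (auto simp: rad_sign_def)

lemma cube_avg_sym_diff:
  assumes "U \<subseteq> {..<N}"
  shows "cube_avg N (\<lambda>S. f (sym_diff S U)) = cube_avg N f"
  unfolding cube_avg_def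
  by (rule arg_cong[where f = "\<lambda>t. t / 2 ^ N"],
      rule sum.reindex_bij_witness[where i = "\<lambda>S. sym_diff S U" and j = "\<lambda>S. sym_diff S U"])
    (use assms in \<open>blast+\<close>)

text \<open>The complex contraction principle with constant \<open>\<pi>/2\<close>: unimodular multipliers are
  combinations of sign patterns with total weight at most \<open>\<pi>/2\<close>, and multiplying by a fixed sign
  pattern only permutes the cube.\<close>
lemma rademacher_contraction:
  fixes a :: "nat \<Rightarrow> 'a::complex_normed_vector"
  assumes "\<And>k. k < N \<Longrightarrow> cmod (z k) = 1" "1 \<le> p"
  shows "cube_avg N (\<lambda>S. norm (\<Sum>k<N. rad_sign S k *\<^sub>R (z k *\<^sub>C a k)) powr p)
    \<le> (pi / 2) powr p * cube_avg N (\<lambda>S. norm (\<Sum>k<N. rad_sign S k *\<^sub>R a k) powr p)"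
proof -
  obtain c :: "nat set \<Rightarrow> complex" where c: "\<And>k. k < N \<Longrightarrow> z k = (\<Sum>S\<in>Pow {..<N}. c S * rad_sign S k)"
    and c_sum: "(\<Sum>S\<in>Pow {..<N}. cmod (c S)) \<le> pi / 2"
    using unimodular_sign_decomposition[of N z thesis, OF assms(1)] by blast
  let ?F = "\<lambda>S. norm (\<Sum>k<N. rad_sign S k *\<^sub>R a k)"
  let ?C = "\<Sum>S\<in>Pow {..<N}. cmod (c S)"
  have C0: "0 \<le> ?C" by (rule sum_nonneg) simp
  have eq: "(\<Sum>k<N. rad_sign S k *\<^sub>R (z k *\<^sub>C a k))
    = (\<Sum>U\<in>Pow {..<N}. c U *\<^sub>C (\<Sum>k<N. rad_sign (sym_diff S U) k *\<^sub>R a k))" for S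
  proof -
    have "(\<Sum>k<N. rad_sign S k *\<^sub>R (z k *\<^sub>C a k))
      = (\<Sum>k<N. \<Sum>U\<in>Pow {..<N}. c U *\<^sub>C (rad_sign (sym_diff S U) k *\<^sub>R a k))"
      by (intro sum.cong refl)
        (simp add: c scaleC_sum_left rad_sign_sym_diff scaleR_scaleC scaleC_scaleC scaleC_sum_right mult_ac)
    then show ?thesis by (subst (asm) sum.swap) (simp add: scaleC_sum_right)
  qed
  have "norm (\<Sum>k<N. rad_sign S k *\<^sub>R (z k *\<^sub>C a k)) powr p
    \<le> ?C powr (p - 1) * (\<Sum>U\<in>Pow {..<N}. cmod (c U) * ?F (sym_diff S U) powr p)" for S
  proof -
    have "norm (\<Sum>k<N. rad_sign S k *\<^sub>R (z k *\<^sub>C a k)) \<le> (\<Sum>U\<in>Pow {..<N}. cmod (c U) * ?F (sym_diff S U))"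
      unfolding eq by (rule order_trans[OF norm_sum]) (simp add: norm_scaleC)
    then have "norm (\<Sum>k<N. rad_sign S k *\<^sub>R (z k *\<^sub>C a k)) powr p
      \<le> (\<Sum>U\<in>Pow {..<N}. cmod (c U) * ?F (sym_diff S U)) powr p"
      using assms(2) by (intro powr_mono2) auto
    also have "\<dots> \<le> ?C powr (p - 1) * (\<Sum>U\<in>Pow {..<N}. cmod (c U) * ?F (sym_diff S U) powr p)"
      using assms(2) by (intro weighted_power_mean) auto
    finally show ?thesis .
  qed
  then have "cube_avg N (\<lambda>S. norm (\<Sum>k<N. rad_sign S k *\<^sub>R (z k *\<^sub>C a k)) powr p)
    \<le> cube_avg N (\<lambda>S. ?C powr (p - 1) * (\<Sum>U\<in>Pow {..<N}. cmod (c U) * ?F (sym_diff S U) powr p))"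
    by (rule cube_avg_mono)
  also have "\<dots> = ?C powr (p - 1) * (\<Sum>U\<in>Pow {..<N}. cmod (c U) * cube_avg N (\<lambda>S. ?F (sym_diff S U) powr p))"
    unfolding cube_avg_linear cube_avg_sum ..
  also have "\<dots> = ?C powr (p - 1) * (\<Sum>U\<in>Pow {..<N}. cmod (c U) * cube_avg N (\<lambda>S. ?F S powr p))"
    using cube_avg_sym_diff[where f = "\<lambda>S. ?F S powr p"] by simp
  also have "\<dots> = ?C powr p * cube_avg N (\<lambda>S. ?F S powr p)"
    using C0 powr_mult_base[OF C0, of "p - 1"] by (simp add: sum_distrib_right[symmetric] mult_ac)
  also have "\<dots> \<le> (pi / 2) powr p * cube_avg N (\<lambda>S. ?F S powr p)"
    using c_sum C0 assms(2) by (intro mult_right_mono powr_mono2 cube_avg_nonneg) auto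
  finally show ?thesis .
qed

section \<open>Tetrahedral polynomials\<close>

lemma scaleR_scaleC_left: "r *\<^sub>R (z *\<^sub>C (b :: 'a::complex_normed_vector)) = (complex_of_real r * z) *\<^sub>C b"
  by (simp add: scaleR_scaleC scaleC_scaleC)

lemma finite_tetra_index [simp]: "finite (tetra_index n m)"
  unfolding tetra_index_def by (rule finite_subset[of _ "Pow {..<n}"]) auto

text \<open>P is affine in each variable, and this is its partial derivative in the k-th
  one.\<close>

definition tetra_partial ::
  "nat \<Rightarrow> nat \<Rightarrow> (nat set \<Rightarrow> 'a::complex_normed_vector) \<Rightarrow> nat \<Rightarrow> (nat \<Rightarrow> complex) \<Rightarrow> 'a" where
  "tetra_partial n m x k w = (\<Sum>A\<in>{A \<in> tetra_index n m. k \<in> A}. (\<Prod>j\<in>A - {k}. w j) *\<^sub>C x A)"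

text \<open>Multiplying the k-th derivative by w_k restores the monomials that contain w_k and omits
  the others. With all \<open>a k\<close> equal to 1 this is Euler's identity; random signs in place
  of \<open>a k\<close> give \<open>tetra_rad\<close>.\<close>

lemma sum_scaleC_tetra_partial:
  "(\<Sum>k<n. (a k * w k) *\<^sub>C tetra_partial n m x k w)
    = (\<Sum>A\<in>tetra_index n m. ((\<Sum>k\<in>A. a k) * (\<Prod>k\<in>A. w k)) *\<^sub>C x A)"
proof -
  have fin: "finite A" if "A \<in> tetra_index n m" for A
    using that by (auto simp: tetra_index_def intro: finite_subset)
  have "(\<Sum>k<n. (a k * w k) *\<^sub>C tetra_partial n m x k w)
    = (\<Sum>k<n. \<Sum>A\<in>{A \<in> tetra_index n m. k \<in> A}. (a k * (\<Prod>j\<in>A. w j)) *\<^sub>C x A)"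
    unfolding tetra_partial_def scaleC_sum_right scaleC_scaleC
  proof (intro sum.cong refl)
    fix k A assume "A \<in> {A \<in> tetra_index n m. k \<in> A}"
    then show "(a k * w k * (\<Prod>j\<in>A - {k}. w j)) *\<^sub>C x A = (a k * (\<Prod>j\<in>A. w j)) *\<^sub>C x A"
      using prod.remove[OF fin[of A], of k w] by (simp add: mult.assoc)
  qed
  also have "\<dots> = (\<Sum>A\<in>tetra_index n m. \<Sum>k\<in>{k\<in>{..<n}. k \<in> A}. (a k * (\<Prod>j\<in>A. w j)) *\<^sub>C x A)"
    by (rule sum.swap_restrict) auto
  also have "\<dots> = (\<Sum>A\<in>tetra_index n m. ((\<Sum>k\<in>A. a k) * (\<Prod>k\<in>A. w k)) *\<^sub>C x A)"
  proof (intro sum.cong refl)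
    fix A assume "A \<in> tetra_index n m"
    then have "{k\<in>{..<n}. k \<in> A} = A" by (auto simp: tetra_index_def)
    then show "(\<Sum>k\<in>{k\<in>{..<n}. k \<in> A}. (a k * (\<Prod>j\<in>A. w j)) *\<^sub>C x A)
      = ((\<Sum>k\<in>A. a k) * (\<Prod>k\<in>A. w k)) *\<^sub>C x A"
      by (simp add: scaleC_sum_left sum_distrib_right)
  qed
  finally show ?thesis .
qed

text \<open>Every set B of the right size is the image of as many injections as there are bijections
  from S onto B.\<close>

lemma sum_injections_by_image:
  fixes h :: "nat set \<Rightarrow> 'a::real_vector"
  assumes "finite S" "finite T"
  shows "(\<Sum>g\<in>{g \<in> S \<rightarrow>\<^sub>E T. inj_on g S}. h (g ` S))
    = fact (card S) *\<^sub>R (\<Sum>B\<in>{B. B \<subseteq> T \<and> card B = card S}. h B)"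
proof -
  let ?I = "\<lambda>T. {g \<in> S \<rightarrow>\<^sub>E T. inj_on g S}" and ?B = "{B. B \<subseteq> T \<and> card B = card S}"
  have fin: "finite (?I T)" "finite ?B"
    using assms by (auto intro: finite_subset[of _ "S \<rightarrow>\<^sub>E T"] finite_PiE)
  have "(\<Sum>g\<in>?I T. h (g ` S)) = (\<Sum>B\<in>?B. \<Sum>g\<in>{g \<in> ?I T. g ` S = B}. h (g ` S))"
    by (rule sum.group[symmetric, OF fin]) (auto simp: card_image)
  also have "\<dots> = (\<Sum>B\<in>?B. fact (card S) *\<^sub>R h B)"
  proof (rule sum.cong[OF refl])
    fix B assume B: "B \<in> ?B"
    then have finB: "finite B" using assms by (auto intro: finite_subset)
    have "{g \<in> ?I T. g ` S = B} = ?I B"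
    proof (intro set_eqI iffI)
      fix g assume "g \<in> {g \<in> ?I T. g ` S = B}"
      then show "g \<in> ?I B" by (auto simp: PiE_iff)
    next
      fix g assume g: "g \<in> ?I B"
      then have "g ` S \<subseteq> B" "card (g ` S) = card B" using B by (auto simp: card_image)
      then have "g ` S = B" by (rule card_subset_eq[OF finB])
      then show "g \<in> {g \<in> ?I T. g ` S = B}" using g B by (auto simp: PiE_iff)
    qed
    moreover have "card (?I B) = fact (card S)"
      using card_inj_on_subset_funcset[OF assms(1) finB order_refl] B by (simp add: fact_prod_rev)
    moreover have "(\<Sum>g\<in>{g \<in> ?I T. g ` S = B}. h (g ` S)) = (\<Sum>g\<in>{g \<in> ?I T. g ` S = B}. h B)"
      by (intro sum.cong) auto
    ultimately show "(\<Sum>g\<in>{g \<in> ?I T. g ` S = B}. h (g ` S)) = fact (card S) *\<^sub>R h B"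
      by (simp only: sum_constant_scaleR of_nat_fact)
  qed
  finally show ?thesis by (simp add: scaleR_sum_right)
qed

text \<open>An injection of \<open>{..<m}\<close> is its value k at 0 together with an injection of
  the other m - 1 arguments that avoids k. The summand depends only on k and the image of the
  latter, which is attained (m - 1)! times; this number and the factor m cancel against
  1/m!.\<close>

lemma tetra_sym_eq_tetra_partial:
  assumes "m \<ge> 1"
  shows "real m *\<^sub>R tetra_sym n m x (\<lambda>j. if j = 0 then w' else w)
    = (\<Sum>k<n. w' k *\<^sub>C tetra_partial n m x k w)"
proof -
  define S where "S = {1..<m}"
  have S: "0 \<notin> S" "{..<m} = insert 0 S" "finite S" "card S = m - 1" using assms by (auto simp: S_def)
  let ?I = "\<lambda>k. {g \<in> S \<rightarrow>\<^sub>E ({..<n} - {k}). inj_on g S}"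
  let ?zs = "\<lambda>j. if j = 0 then w' else w"
  have finI: "finite (?I k)" for k
    by (rule finite_subset[of _ "S \<rightarrow>\<^sub>E ({..<n} - {k})"]) (auto intro: finite_PiE S(3))
  have inner: "(\<Sum>g\<in>?I k. (w' k * (\<Prod>j\<in>S. w (g j))) *\<^sub>C x (insert k (g ` S)))
    = fact (m - 1) *\<^sub>R (w' k *\<^sub>C tetra_partial n m x k w)" if k: "k < n" for k
  proof -
    let ?h = "\<lambda>B. (w' k * (\<Prod>j\<in>B. w j)) *\<^sub>C x (insert k B)"
    have "(\<Sum>g\<in>?I k. (w' k * (\<Prod>j\<in>S. w (g j))) *\<^sub>C x (insert k (g ` S))) = (\<Sum>g\<in>?I k. ?h (g ` S))"
      by (intro sum.cong refl) (simp add: prod.reindex)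
    also have "\<dots> = fact (m - 1) *\<^sub>R (\<Sum>B\<in>{B. B \<subseteq> {..<n} - {k} \<and> card B = m - 1}. ?h B)"
      using sum_injections_by_image[OF S(3), of "{..<n} - {k}" ?h] by (simp add: S(4))
    also have "(\<Sum>B\<in>{B. B \<subseteq> {..<n} - {k} \<and> card B = m - 1}. ?h B)
      = (\<Sum>A\<in>{A \<in> tetra_index n m. k \<in> A}. (w' k * (\<Prod>j\<in>A - {k}. w j)) *\<^sub>C x A)"
    proof (rule sum.reindex_bij_witness[where i = "\<lambda>A. A - {k}" and j = "insert k"])
      fix B assume B: "B \<in> {B. B \<subseteq> {..<n} - {k} \<and> card B = m - 1}"
      then have *: "finite B" "k \<notin> B" by (auto intro: finite_subset)
      then show "insert k B - {k} = B" by simp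
      then show "(w' k * (\<Prod>j\<in>insert k B - {k}. w j)) *\<^sub>C x (insert k B) = ?h B" by simp
      show "insert k B \<in> {A \<in> tetra_index n m. k \<in> A}"
        using B * k assms by (auto simp: tetra_index_def)
    next
      fix A assume A: "A \<in> {A \<in> tetra_index n m. k \<in> A}"
      then have "finite A" by (auto simp: tetra_index_def intro: finite_subset)
      with A show "A - {k} \<in> {B. B \<subseteq> {..<n} - {k} \<and> card B = m - 1}" "insert k (A - {k}) = A"
        by (auto simp: tetra_index_def)
    qed
    finally show ?thesis
      by (simp add: tetra_partial_def scaleC_sum_right scaleC_scaleC)
  qed
  have "(\<Sum>f\<in>{f. f \<in> {..<m} \<rightarrow>\<^sub>E {..<n} \<and> inj_on f {..<m}}. (\<Prod>j<m. ?zs j (f j)) *\<^sub>C x (f ` {..<m}))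
    = (\<Sum>(k, g)\<in>(SIGMA k:{..<n}. ?I k). (w' k * (\<Prod>j\<in>S. w (g j))) *\<^sub>C x (insert k (g ` S)))"
    unfolding S(2)
  proof (subst extensional_funcset_extend_domain_inj_on_eq[OF S(1)],
      subst sum.reindex[OF extensional_funcset_extend_domain_inj_onI[OF S(1)]], rule sum.cong)
    fix kg assume "kg \<in> (SIGMA k:{..<n}. ?I k)"
    obtain k g where kg: "kg = (k, g)" by force
    have "(\<Prod>j\<in>S. ?zs j ((g(0 := k)) j)) = (\<Prod>j\<in>S. w (g j))"
      using S(1) by (intro prod.cong) auto
    moreover have "(g(0 := k)) ` S = g ` S" using S(1) by (intro image_cong) auto
    ultimately show "((\<lambda>f. (\<Prod>j\<in>insert 0 S. ?zs j (f j)) *\<^sub>C x (f ` insert 0 S)) \<circ> (\<lambda>(y, g). g(0 := y))) kg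
      = (case kg of (k, g) \<Rightarrow> (w' k * (\<Prod>j\<in>S. w (g j))) *\<^sub>C x (insert k (g ` S)))"
      using S by (simp add: kg)
  qed auto
  also have "\<dots> = (\<Sum>k<n. \<Sum>g\<in>?I k. (w' k * (\<Prod>j\<in>S. w (g j))) *\<^sub>C x (insert k (g ` S)))"
    by (rule sum.Sigma[symmetric]) (use finI in auto)
  also have "\<dots> = fact (m - 1) *\<^sub>R (\<Sum>k<n. w' k *\<^sub>C tetra_partial n m x k w)"
    unfolding scaleR_sum_right by (intro sum.cong refl inner) simp
  finally have sum_eq: "(\<Sum>f\<in>{f. f \<in> {..<m} \<rightarrow>\<^sub>E {..<n} \<and> inj_on f {..<m}}. (\<Prod>j<m. ?zs j (f j)) *\<^sub>C x (f ` {..<m}))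
    = fact (m - 1) *\<^sub>R (\<Sum>k<n. w' k *\<^sub>C tetra_partial n m x k w)" .
  have "real m *\<^sub>R tetra_sym n m x ?zs
    = (real m * (1 / fact m) * fact (m - 1)) *\<^sub>R (\<Sum>k<n. w' k *\<^sub>C tetra_partial n m x k w)"
    by (simp only: tetra_sym_def sum_eq scaleR_scaleC[symmetric] scaleR_scaleR mult.assoc)
  also have "real m * (1 / fact m) * fact (m - 1) = (1::real)"
    using assms by (subst fact_reduce[of m]) auto
  finally show ?thesis by simp
qed

text \<open>These numbers are unimodular when \<open>c\<^sup>2 + s\<^sup>2 = 1\<close>; the choice \<open>s\<^sup>2 = 1/m\<close> maximizes the
  coefficient \<open>s c\<^sup>m\<^sup>-\<^sup>1\<close> of a single sign in a product of \<open>m\<close> of them.\<close>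
definition cube_rot :: "real \<Rightarrow> real \<Rightarrow> nat set \<Rightarrow> nat \<Rightarrow> complex" where
  "cube_rot c s S k = of_real c + \<i> * of_real (s * rad_sign S k)"

section \<open>The random unimodular substitution and its level-one part\<close>

definition tetra_rad where
  "tetra_rad n m x w S = (\<Sum>k<n. rad_sign S k *\<^sub>R (w k *\<^sub>C tetra_partial n m x k w))"

lemma tetra_rad_eq:
  "tetra_rad n m x w S
    = (\<Sum>A\<in>tetra_index n m. ((\<Sum>k\<in>A. of_real (rad_sign S k)) * (\<Prod>k\<in>A. w k)) *\<^sub>C x A)"
  unfolding tetra_rad_def scaleR_scaleC_left by (rule sum_scaleC_tetra_partial)

text \<open>Averaging over one coordinate turns the k-th multiplier times its sign into i s, every
  other multiplier in A into c, and the empty factor outside A into 1.\<close>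

lemma sum_rad_sign_cube_rot:
  assumes "A \<subseteq> {..<n}" "k \<in> A"
  shows "(\<Sum>S\<in>Pow {..<n}. of_real (rad_sign S k) * (\<Prod>j\<in>A. cube_rot c s S j))
    = 2 ^ n * (\<i> * of_real (s * c ^ (card A - 1)))"
proof -
  have fin: "finite A" using assms(1) by (rule finite_subset) simp
  let ?h = "\<lambda>i t. (if i \<in> A then of_real c + \<i> * of_real (s * t) else 1) * (if i = k then of_real t else 1) :: complex"
  have "(\<Sum>S\<in>Pow {..<n}. of_real (rad_sign S k) * (\<Prod>j\<in>A. cube_rot c s S j))
    = (\<Sum>S\<in>Pow {..<n}. \<Prod>i<n. ?h i (rad_sign S i))"
    using assms by (intro sum.cong refl)
      (auto simp: prod.distrib prod.If_cases Int_absorb1 cube_rot_def mult.commute)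
  also have "\<dots> = (\<Prod>i<n. ?h i 1 + ?h i (-1))" by (rule prod_rad_sign_expand)
  also have "\<dots> = (\<Prod>i<n. 2 * (if i \<in> A then (if i = k then \<i> * of_real s else of_real c) else 1))"
    using assms(2) by (intro prod.cong refl) auto
  also have "\<dots> = 2 ^ n * (\<Prod>i\<in>A. if i = k then \<i> * of_real s else of_real c)"
    using assms(1) by (simp add: prod.distrib prod.If_cases Int_absorb1)
  also have "(\<Prod>i\<in>A. if i = k then \<i> * of_real s else of_real c) = \<i> * of_real (s * c ^ (card A - 1))"
    using fin assms(2) by (subst prod.remove[of A k]) auto
  finally show ?thesis .
qed

text \<open>Every k in a set A of m elements contributes the same i s c^(m-1), so the average of the
  Rademacher sum over the substitutions is a fixed multiple of P(w).\<close>

lemma sum_tetra_rad_rot: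
  "(\<Sum>S\<in>Pow {..<n}. tetra_rad n m x (\<lambda>k. cube_rot c s S k * w k) S)
    = (2 ^ n * (\<i> * of_real (real m * s * c ^ (m - 1)))) *\<^sub>C tetra_poly n m x w"
proof -
  have "(\<Sum>S\<in>Pow {..<n}. tetra_rad n m x (\<lambda>k. cube_rot c s S k * w k) S)
    = (\<Sum>A\<in>tetra_index n m. \<Sum>S\<in>Pow {..<n}.
        ((\<Sum>k\<in>A. of_real (rad_sign S k)) * (\<Prod>k\<in>A. cube_rot c s S k * w k)) *\<^sub>C x A)"
    unfolding tetra_rad_eq by (rule sum.swap)
  also have "\<dots> = (\<Sum>A\<in>tetra_index n m.
      ((\<Sum>k\<in>A. \<Sum>S\<in>Pow {..<n}. of_real (rad_sign S k) * (\<Prod>j\<in>A. cube_rot c s S j)) * (\<Prod>k\<in>A. w k)) *\<^sub>C x A)"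
    unfolding scaleC_sum_left[symmetric]
    by (subst sum.swap[of _ "Pow {..<n}"]) (simp only: prod.distrib sum_distrib_right mult.assoc)
  also have "\<dots> = (\<Sum>A\<in>tetra_index n m.
      ((2 ^ n * (\<i> * of_real (real m * s * c ^ (m - 1)))) * (\<Prod>k\<in>A. w k)) *\<^sub>C x A)"
  proof (intro sum.cong refl)
    fix A assume "A \<in> tetra_index n m"
    then have A: "A \<subseteq> {..<n}" "card A = m" by (auto simp: tetra_index_def)
    have "(\<Sum>k\<in>A. \<Sum>S\<in>Pow {..<n}. of_real (rad_sign S k) * (\<Prod>j\<in>A. cube_rot c s S j))
      = (\<Sum>k\<in>A. 2 ^ n * (\<i> * of_real (s * c ^ (m - 1))))"
      using sum_rad_sign_cube_rot[OF A(1)] A(2) by (intro sum.cong refl) simp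
    then show "((\<Sum>k\<in>A. \<Sum>S\<in>Pow {..<n}. of_real (rad_sign S k) * (\<Prod>j\<in>A. cube_rot c s S j)) * (\<Prod>k\<in>A. w k)) *\<^sub>C x A
      = ((2 ^ n * (\<i> * of_real (real m * s * c ^ (m - 1)))) * (\<Prod>k\<in>A. w k)) *\<^sub>C x A"
      by (simp add: A(2) mult_ac)
  qed
  finally show ?thesis
    by (simp only: tetra_poly_def scaleC_sum_right scaleC_scaleC)
qed

text \<open>The triangle inequality for this average, followed by comparison of the L^1 with the L^p
  norm on the cube. The estimate is pointwise in w, with the rotation still present on the
  right.\<close>

lemma tetra_poly_le_cube_avg:
  assumes "1 \<le> p" "0 \<le> c" "0 \<le> s"
  shows "(real m * s * c ^ (m - 1) * norm (tetra_poly n m x w)) powr p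
    \<le> cube_avg n (\<lambda>S. norm (tetra_rad n m x (\<lambda>k. cube_rot c s S k * w k) S) powr p)"
proof -
  let ?g = "\<lambda>S. tetra_rad n m x (\<lambda>k. cube_rot c s S k * w k) S"
  have "2 ^ n * (real m * s * c ^ (m - 1) * norm (tetra_poly n m x w)) = norm (\<Sum>S\<in>Pow {..<n}. ?g S)"
    using assms by (simp add: sum_tetra_rad_rot norm_scaleC norm_mult norm_power)
  also have "\<dots> \<le> (\<Sum>S\<in>Pow {..<n}. norm (?g S))" by (rule norm_sum)
  finally have "real m * s * c ^ (m - 1) * norm (tetra_poly n m x w) \<le> cube_avg n (\<lambda>S. norm (?g S))"
    by (simp add: cube_avg_def field_simps)
  also have "\<dots> = Lp_cube n 1 ?g" by (simp add: Lp_cube_alt cube_avg_nonneg)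
  also have "\<dots> \<le> Lp_cube n p ?g" using assms(1) by (intro Lp_cube_mono_exponent) auto
  finally have "(real m * s * c ^ (m - 1) * norm (tetra_poly n m x w)) powr p \<le> Lp_cube n p ?g powr p"
    using assms by (intro powr_mono2) auto
  then show ?thesis using assms(1) by (simp add: Lp_cube_powr)
qed

text \<open>The Walsh coefficients of \<open>S \<mapsto> P(v\<^sub>S w)\<close>, where \<open>v\<^sub>S\<close> is \<^term>\<open>cube_rot c s S\<close>.\<close>
definition rot_coeff where
  "rot_coeff n m x c s w B = (\<Sum>A\<in>{A \<in> tetra_index n m. B \<subseteq> A}.
     ((\<i> * of_real s) ^ card B * of_real c ^ (m - card B) * (\<Prod>k\<in>A. w k)) *\<^sub>C x A)"

text \<open>Each product over A is expanded by choosing the set B of factors that supply i s times a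
  sign, the others supplying c.\<close>

lemma walsh_rot_coeff:
  "walsh n (rot_coeff n m x c s w) S = tetra_poly n m x (\<lambda>k. cube_rot c s S k * w k)"
proof -
  have "walsh n (rot_coeff n m x c s w) S
    = (\<Sum>B\<in>Pow {..<n}. \<Sum>A\<in>{A \<in> tetra_index n m. B \<subseteq> A}.
       (of_real (\<Prod>i\<in>B. rad_sign S i) * ((\<i> * of_real s) ^ card B * of_real c ^ (m - card B) * (\<Prod>k\<in>A. w k))) *\<^sub>C x A)"
    unfolding walsh_def rot_coeff_def scaleR_sum_right scaleR_scaleC_left ..
  also have "\<dots> = (\<Sum>A\<in>tetra_index n m. \<Sum>B\<in>{B \<in> Pow {..<n}. B \<subseteq> A}.
       (of_real (\<Prod>i\<in>B. rad_sign S i) * ((\<i> * of_real s) ^ card B * of_real c ^ (m - card B) * (\<Prod>k\<in>A. w k))) *\<^sub>C x A)"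
    by (rule sum.swap_restrict) auto
  also have "\<dots> = tetra_poly n m x (\<lambda>k. cube_rot c s S k * w k)"
    unfolding tetra_poly_def
  proof (intro sum.cong refl)
    fix A assume "A \<in> tetra_index n m"
    then have A: "A \<subseteq> {..<n}" "card A = m" "finite A" by (auto simp: tetra_index_def intro: finite_subset)
    then have Pow: "{B \<in> Pow {..<n}. B \<subseteq> A} = Pow A" by auto
    have "(\<Prod>k\<in>A. cube_rot c s S k) = (\<Prod>k\<in>A. \<i> * of_real (s * rad_sign S k) + of_real c)"
      by (simp add: cube_rot_def add.commute)
    also have "\<dots> = (\<Sum>B\<in>Pow A. (\<Prod>k\<in>B. \<i> * of_real (s * rad_sign S k)) * (\<Prod>k\<in>A - B. of_real c))"
      by (rule prod_add[OF A(3)])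
    also have "\<dots> = (\<Sum>B\<in>Pow A. of_real (\<Prod>i\<in>B. rad_sign S i) * ((\<i> * of_real s) ^ card B * of_real c ^ (m - card B)))"
    proof (intro sum.cong refl)
      fix B assume "B \<in> Pow A"
      then have "card (A - B) = m - card B" using A by (auto intro: card_Diff_subset finite_subset)
      then show "(\<Prod>k\<in>B. \<i> * of_real (s * rad_sign S k)) * (\<Prod>k\<in>A - B. of_real c)
        = of_real (\<Prod>i\<in>B. rad_sign S i) * ((\<i> * of_real s) ^ card B * of_real c ^ (m - card B))"
        by (simp add: prod.distrib power_mult_distrib mult_ac)
    qed
    finally show "(\<Sum>B\<in>{B \<in> Pow {..<n}. B \<subseteq> A}. (of_real (\<Prod>i\<in>B. rad_sign S i) *
          ((\<i> * of_real s) ^ card B * of_real c ^ (m - card B) * (\<Prod>k\<in>A. w k))) *\<^sub>C x A)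
      = (\<Prod>k\<in>A. cube_rot c s S k * w k) *\<^sub>C x A"
      by (simp only: Pow prod.distrib scaleC_sum_left sum_distrib_right mult.assoc)
  qed
  finally show ?thesis .
qed

text \<open>Only singletons survive the projection, and all of them carry the same scalar i s
  c^(m-1), which factors out.\<close>

lemma rad_proj_rot_coeff:
  "rad_proj n (rot_coeff n m x c s w) S = (\<i> * of_real (s * c ^ (m - 1))) *\<^sub>C tetra_rad n m x w S"
proof -
  have "rad_proj n (rot_coeff n m x c s w) S
    = (\<Sum>i<n. \<Sum>A\<in>{A \<in> tetra_index n m. i \<in> A}.
       (of_real (rad_sign S i) * (\<i> * of_real s * of_real c ^ (m - 1) * (\<Prod>k\<in>A. w k))) *\<^sub>C x A)"
    unfolding rad_proj_def rot_coeff_def scaleR_sum_right scaleR_scaleC_left by simp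
  also have "\<dots> = (\<Sum>A\<in>tetra_index n m. \<Sum>i\<in>{i \<in> {..<n}. i \<in> A}.
       (of_real (rad_sign S i) * (\<i> * of_real s * of_real c ^ (m - 1) * (\<Prod>k\<in>A. w k))) *\<^sub>C x A)"
    by (rule sum.swap_restrict) auto
  also have "\<dots> = (\<Sum>A\<in>tetra_index n m. (\<i> * of_real (s * c ^ (m - 1)) *
      ((\<Sum>k\<in>A. of_real (rad_sign S k)) * (\<Prod>k\<in>A. w k))) *\<^sub>C x A)"
  proof (intro sum.cong refl)
    fix A assume "A \<in> tetra_index n m"
    then have *: "{i \<in> {..<n}. i \<in> A} = A" by (auto simp: tetra_index_def)
    have "(\<Sum>i\<in>A. of_real (rad_sign S i) * (\<i> * of_real s * of_real c ^ (m - 1) * (\<Prod>k\<in>A. w k)))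
      = \<i> * of_real (s * c ^ (m - 1)) * ((\<Sum>k\<in>A. of_real (rad_sign S k)) * (\<Prod>k\<in>A. w k))"
      unfolding sum_distrib_right[symmetric] by simp
    then show "(\<Sum>i\<in>{i \<in> {..<n}. i \<in> A}.
       (of_real (rad_sign S i) * (\<i> * of_real s * of_real c ^ (m - 1) * (\<Prod>k\<in>A. w k))) *\<^sub>C x A)
      = (\<i> * of_real (s * c ^ (m - 1)) * ((\<Sum>k\<in>A. of_real (rad_sign S k)) * (\<Prod>k\<in>A. w k))) *\<^sub>C x A"
      by (simp only: * scaleC_sum_left[symmetric])
  qed
  finally show ?thesis
    by (simp only: tetra_rad_eq scaleC_sum_right scaleC_scaleC)
qed

lemma cube_avg_tetra_rad_le:
  fixes x :: "nat set \<Rightarrow> 'a::complex_normed_vector"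
  assumes "K_convex TYPE('a)" "1 < p" "0 \<le> c" "0 \<le> s"
  shows "(s * c ^ (m - 1)) powr p * cube_avg n (\<lambda>S. norm (tetra_rad n m x w S) powr p)
    \<le> \<bar>K_const p TYPE('a)\<bar> powr p * cube_avg n (\<lambda>S. norm (tetra_poly n m x (\<lambda>k. cube_rot c s S k * w k)) powr p)"
proof -
  let ?x = "rot_coeff n m x c s w" and ?K = "K_const p TYPE('a)"
  have "Lp_cube n p (rad_proj n ?x) \<le> ?K * Lp_cube n p (walsh n ?x)"
    by (rule rad_proj_le_K_const[OF assms(1,2)])
  \<comment> \<open>The real power needs a nonnegative base, and the sign of \<open>K_const\<close>
    is not known in the zero space.\<close>
  also have "\<dots> \<le> \<bar>?K\<bar> * Lp_cube n p (walsh n ?x)"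
    by (intro mult_right_mono Lp_cube_nonneg) simp
  finally have "Lp_cube n p (rad_proj n ?x) powr p \<le> (\<bar>?K\<bar> * Lp_cube n p (walsh n ?x)) powr p"
    using assms by (intro powr_mono2 Lp_cube_nonneg) auto
  then show ?thesis
    using assms by (simp add: powr_mult Lp_cube_powr walsh_rot_coeff rad_proj_rot_coeff
        norm_scaleC norm_mult norm_power cube_avg_linear abs_of_nonneg mult.assoc)
qed

section \<open>Integration over Steinhaus vectors\<close>

lemma prob_space_steinhaus_vec: "prob_space (steinhaus_vec n)"
  unfolding steinhaus_vec_def by (intro prob_space_PiM prob_space_steinhaus)

lemma AE_steinhaus_vec: "AE w in steinhaus_vec n. \<forall>k<n. cmod (w k) = 1"
proof -
  have "AE w in steinhaus_vec n. \<forall>k\<in>{..<n}. cmod (w k) = 1"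
    unfolding steinhaus_vec_def
    by (intro AE_finite_allI AE_PiM_component[where P = "\<lambda>z. cmod z = 1"] prob_space_steinhaus AE_steinhaus) auto
  then show ?thesis by (rule eventually_mono) auto
qed

lemma coord_measurable: "k < n \<Longrightarrow> (\<lambda>w. w k) \<in> borel_measurable (steinhaus_vec n)"
  unfolding steinhaus_vec_def
  using measurable_component_singleton[of k "{..<n}" "\<lambda>_. steinhaus"]
  by (simp cong: measurable_cong_sets)

lemma zero_extension_measurable [measurable]:
  "(\<lambda>w k. if k < n then w k else 0) \<in> borel_measurable (steinhaus_vec n)"
proof (rule measurable_coordinatewise_then_product)
  show "(\<lambda>w. if k < n then w k else 0) \<in> borel_measurable (steinhaus_vec n)" for k
    by (cases "k < n") (simp_all add: coord_measurable)
qed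

text \<open>Points of the space of \<^term>\<open>steinhaus_vec n\<close> are undefined outside \<open>{..<n}\<close>, while continuity
  refers to the product topology on all sequences; functions of the first \<open>n\<close> coordinates bridge this.\<close>
definition fin_dep :: "nat \<Rightarrow> ((nat \<Rightarrow> complex) \<Rightarrow> 'b) \<Rightarrow> bool" where
  "fin_dep n f \<longleftrightarrow> (\<forall>w w'. (\<forall>k<n. w k = w' k) \<longrightarrow> f w = f w')"

lemma fin_depD: "fin_dep n f \<Longrightarrow> (\<And>k. k < n \<Longrightarrow> w k = w' k) \<Longrightarrow> f w = f w'"
  unfolding fin_dep_def by blast

lemma rotation_measurable:
  "(\<lambda>w. \<lambda>k\<in>{..<n}. v k * w k) \<in> measurable (steinhaus_vec n) (steinhaus_vec n)"
  unfolding steinhaus_vec_def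
  by (rule measurable_restrict) (use coord_measurable[unfolded steinhaus_vec_def] in \<open>auto cong: measurable_cong_sets\<close>)

text \<open>It suffices to compare both measures on boxes, where independence reduces the claim to
  the rotation invariance of each coordinate.\<close>

lemma steinhaus_vec_rotate:
  assumes v: "\<And>k. k < n \<Longrightarrow> cmod (v k) = 1"
  shows "distr (steinhaus_vec n) (steinhaus_vec n) (\<lambda>w. \<lambda>k\<in>{..<n}. v k * w k) = steinhaus_vec n"
    (is "distr _ _ ?R = _")
proof -
  interpret P: product_prob_space "\<lambda>_ :: nat. steinhaus"
    by (intro product_prob_spaceI prob_space_steinhaus)
  show ?thesis
    unfolding steinhaus_vec_def
  proof (rule P.PiM_eqI)
    fix A :: "nat \<Rightarrow> complex set" assume A: "\<And>i. i \<in> {..<n} \<Longrightarrow> A i \<in> sets steinhaus"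
    have m: "(*) (v i) -` A i \<in> sets borel" if "i < n" for i
      using measurable_sets[of "(*) (v i)" borel borel "A i"] A[of i] that by simp
    have "emeasure (distr (PiM {..<n} (\<lambda>_. steinhaus)) (PiM {..<n} (\<lambda>_. steinhaus)) ?R) (Pi\<^sub>E {..<n} A)
      = emeasure (PiM {..<n} (\<lambda>_. steinhaus)) (?R -` Pi\<^sub>E {..<n} A \<inter> space (PiM {..<n} (\<lambda>_. steinhaus)))"
      using A rotation_measurable[where n = n and v = v] by (intro emeasure_distr) (auto simp: steinhaus_vec_def intro!: sets_PiM_I_finite)
    also have "?R -` Pi\<^sub>E {..<n} A \<inter> space (PiM {..<n} (\<lambda>_. steinhaus)) = Pi\<^sub>E {..<n} (\<lambda>i. (*) (v i) -` A i)"
      by (auto simp: space_PiM PiE_iff)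
    also have "emeasure (PiM {..<n} (\<lambda>_. steinhaus)) \<dots> = (\<Prod>i<n. emeasure steinhaus ((*) (v i) -` A i))"
      using m by (intro P.emeasure_PiM) auto
    also have "\<dots> = (\<Prod>i<n. emeasure steinhaus (A i))"
    proof (rule prod.cong[OF refl])
      fix i assume "i \<in> {..<n}"
      moreover have "(*) (v i) \<in> borel_measurable steinhaus" by measurable
      ultimately show "emeasure steinhaus ((*) (v i) -` A i) = emeasure steinhaus (A i)"
        using emeasure_distr[of "(*) (v i)" steinhaus borel "A i"] A[of i] steinhaus_rotate[OF v, of i] by simp
    qed
    finally show "emeasure (distr (PiM {..<n} (\<lambda>_. steinhaus)) (PiM {..<n} (\<lambda>_. steinhaus)) ?R) (Pi\<^sub>E {..<n} A)
      = (\<Prod>i<n. emeasure steinhaus (A i))" .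
  qed simp_all
qed

text \<open>Extension by zero is a Borel map from the space of \<open>steinhaus_vec n\<close> into
  all sequences, and f does not see the change.\<close>

lemma fin_dep_measurable:
  fixes f :: "(nat \<Rightarrow> complex) \<Rightarrow> real"
  assumes "continuous_on UNIV f" "fin_dep n f"
  shows "f \<in> borel_measurable (steinhaus_vec n)"
proof -
  have "(\<lambda>w. f (\<lambda>k. if k < n then w k else 0)) \<in> borel_measurable (steinhaus_vec n)"
    by (rule measurable_compose[OF zero_extension_measurable borel_measurable_continuous_onI[OF assms(1)]])
  moreover have "f (\<lambda>k. if k < n then w k else 0) = f w" for w
    by (rule fin_depD[OF assms(2)]) simp
  ultimately show ?thesis by simp
qed

lemma integral_steinhaus_vec_rotate:
  fixes f :: "(nat \<Rightarrow> complex) \<Rightarrow> real"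
  assumes "continuous_on UNIV f" "fin_dep n f" "\<And>k. k < n \<Longrightarrow> cmod (v k) = 1"
  shows "(\<integral>w. f (\<lambda>k. v k * w k) \<partial>steinhaus_vec n) = (\<integral>w. f w \<partial>steinhaus_vec n)"
proof -
  have "(\<integral>w. f w \<partial>steinhaus_vec n)
    = (\<integral>w. f w \<partial>distr (steinhaus_vec n) (steinhaus_vec n) (\<lambda>w. \<lambda>k\<in>{..<n}. v k * w k))"
    by (simp add: steinhaus_vec_rotate assms(3))
  also have "\<dots> = (\<integral>w. f (\<lambda>k\<in>{..<n}. v k * w k) \<partial>steinhaus_vec n)"
    by (intro integral_distr rotation_measurable fin_dep_measurable assms(1,2))
  also have "\<dots> = (\<integral>w. f (\<lambda>k. v k * w k) \<partial>steinhaus_vec n)"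
    by (intro Bochner_Integration.integral_cong refl fin_depD[OF assms(2)]) simp
  finally show ?thesis ..
qed

lemma fin_dep_tetra [simp]:
  "fin_dep n (tetra_poly n m x)" "fin_dep n (tetra_partial n m x k)"
proof -
  have *: "(\<Prod>j\<in>A - B. w j) = (\<Prod>j\<in>A - B. w' j)" if "\<forall>k<n. w k = w' k" "A \<in> tetra_index n m"
    for A B and w w' :: "nat \<Rightarrow> complex"
    using that by (intro prod.cong) (auto simp: tetra_index_def)
  show "fin_dep n (tetra_partial n m x k)"
    unfolding fin_dep_def tetra_partial_def
  proof (intro allI impI sum.cong refl)
    fix w w' :: "nat \<Rightarrow> complex" and A
    assume "\<forall>k<n. w k = w' k" "A \<in> {A \<in> tetra_index n m. k \<in> A}"
    then show "prod w (A - {k}) *\<^sub>C x A = prod w' (A - {k}) *\<^sub>C x A"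
      using *[of w w' A "{k}"] by simp
  qed
  show "fin_dep n (tetra_poly n m x)"
    unfolding fin_dep_def tetra_poly_def
  proof (intro allI impI sum.cong refl)
    fix w w' :: "nat \<Rightarrow> complex" and A
    assume "\<forall>k<n. w k = w' k" "A \<in> tetra_index n m"
    then show "prod w A *\<^sub>C x A = prod w' A *\<^sub>C x A"
      using *[of w w' A "{}"] by simp
  qed
qed

lemma bounded_bilinear_scaleC: "bounded_bilinear (\<lambda>z (b :: 'a::complex_normed_vector). z *\<^sub>C b)"
proof
  show "\<exists>K. \<forall>z (b :: 'a). norm (z *\<^sub>C b) \<le> norm z * norm b * K"
    by (rule exI[of _ 1]) (simp add: norm_scaleC)
qed (simp_all add: scaleC_add_left scaleC_add_right scaleR_scaleC scaleC_scaleC scaleR_conv_of_real mult.commute)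

lemmas continuous_on_scaleC [continuous_intros] =
  bounded_bilinear.continuous_on[OF bounded_bilinear_scaleC]

lemma continuous_on_coordinate:
  fixes f :: "'b::topological_space \<Rightarrow> nat \<Rightarrow> complex"
  assumes "continuous_on S f"
  shows "continuous_on S (\<lambda>t. f t k)"
  by (rule continuous_on_compose2[OF continuous_on_product_coordinates assms]) simp

lemma continuous_on_tetra [continuous_intros]:
  fixes f :: "'b::topological_space \<Rightarrow> nat \<Rightarrow> complex"
  assumes "continuous_on S f"
  shows "continuous_on S (\<lambda>t. tetra_poly n m x (f t))"
    and "continuous_on S (\<lambda>t. tetra_partial n m x k (f t))"
  unfolding tetra_poly_def tetra_partial_def
  by (intro continuous_intros continuous_on_coordinate[OF assms])+

lemma continuous_on_norm_powr:
  assumes "continuous_on S f" "0 < p"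
  shows "continuous_on S (\<lambda>t. norm (f t) powr p)"
  using assms by (intro continuous_on_powr' continuous_intros) auto

definition coeff_norm :: "nat \<Rightarrow> nat \<Rightarrow> (nat set \<Rightarrow> 'a::complex_normed_vector) \<Rightarrow> real" where
  "coeff_norm n m x = (\<Sum>A\<in>tetra_index n m. norm (x A))"

text \<open>Crude bounds by the coefficients alone, there to secure integrability.\<close>

lemma norm_tetra_le:
  assumes "\<And>k. k < n \<Longrightarrow> cmod (w k) = 1"
  shows "norm (tetra_poly n m x w) \<le> coeff_norm n m x"
    and "norm (tetra_partial n m x k w) \<le> coeff_norm n m x"
proof -
  have *: "cmod (\<Prod>j\<in>A - B. w j) = 1" if "A \<in> tetra_index n m" for A B
    using that assms unfolding prod_norm[symmetric]
    by (intro prod.neutral) (auto simp: tetra_index_def)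
  show "norm (tetra_poly n m x w) \<le> coeff_norm n m x"
    unfolding tetra_poly_def coeff_norm_def using *[where B = "{}"]
    by (intro sum_norm_le) (simp add: norm_scaleC)
  have "norm (tetra_partial n m x k w) \<le> (\<Sum>A\<in>{A \<in> tetra_index n m. k \<in> A}. norm (x A))"
    unfolding tetra_partial_def using * by (intro sum_norm_le) (simp add: norm_scaleC)
  also have "\<dots> \<le> coeff_norm n m x"
    unfolding coeff_norm_def by (rule sum_mono2) auto
  finally show "norm (tetra_partial n m x k w) \<le> coeff_norm n m x" .
qed

text \<open>For \<open>S = {}\<close> this is \<open>m M(w', w, \<dots>, w)\<close>, and for \<open>w' = w\<close> it is \<^term>\<open>tetra_rad n m x w S\<close>.\<close>
definition tetra_mix where
  "tetra_mix n m x w' w S = (\<Sum>k<n. rad_sign S k *\<^sub>R (w' k *\<^sub>C tetra_partial n m x k w))"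

lemma norm_tetra_mix_le:
  assumes "\<And>k. k < n \<Longrightarrow> cmod (w k) = 1" "\<And>k. k < n \<Longrightarrow> cmod (w' k) = 1"
  shows "norm (tetra_mix n m x w' w S) \<le> real n * coeff_norm n m x"
proof -
  have "norm (tetra_mix n m x w' w S) \<le> (\<Sum>k<n. coeff_norm n m x)"
    unfolding tetra_mix_def using assms norm_tetra_le(2)[where w = w and n = n and m = m and x = x, OF assms(1)]
    by (intro sum_norm_le) (simp add: norm_scaleC rad_sign_def)
  then show ?thesis by simp
qed

lemma tetra_mix_diag: "tetra_mix n m x w w S = tetra_rad n m x w S"
  by (simp add: tetra_mix_def tetra_rad_def)

section \<open>Pairs of independent vectors and exchange of the linear argument\<close>

interpretation steinhaus_vec: prob_space "steinhaus_vec n" for n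
  by (rule prob_space_steinhaus_vec)

interpretation steinhaus_pair: pair_prob_space "steinhaus_vec n" "steinhaus_vec n" for n ..

abbreviation steinhaus_pair :: "nat \<Rightarrow> ((nat \<Rightarrow> complex) \<times> (nat \<Rightarrow> complex)) measure" where
  "steinhaus_pair n \<equiv> steinhaus_vec n \<Otimes>\<^sub>M steinhaus_vec n"

lemma distr_steinhaus_pair_fst: "distr (steinhaus_pair n) (steinhaus_vec n) fst = steinhaus_vec n"
  by (rule steinhaus_vec.distr_pair_fst)

lemma distr_steinhaus_pair_snd: "distr (steinhaus_pair n) (steinhaus_vec n) snd = steinhaus_vec n"
proof -
  have "distr (steinhaus_pair n) (steinhaus_vec n) snd
    = distr (distr (steinhaus_pair n) (steinhaus_pair n) (\<lambda>(x, y). (y, x))) (steinhaus_vec n) snd"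
    by (simp only: steinhaus_pair.distr_pair_swap[symmetric])
  also have "\<dots> = distr (steinhaus_pair n) (steinhaus_vec n) (snd \<circ> (\<lambda>(x, y). (y, x)))"
    by (rule distr_distr) measurable
  also have "snd \<circ> (\<lambda>(x, y). (y, x)) = (fst :: (nat \<Rightarrow> complex) \<times> (nat \<Rightarrow> complex) \<Rightarrow> _)" by auto
  finally show ?thesis by (simp add: distr_steinhaus_pair_fst)
qed

lemma AE_steinhaus_pair:
  "AE ww in steinhaus_pair n. (\<forall>k<n. cmod (fst ww k) = 1) \<and> (\<forall>k<n. cmod (snd ww k) = 1)"
proof (rule AE_conjI)
  show "AE ww in steinhaus_pair n. \<forall>k<n. cmod (fst ww k) = 1"
    by (rule AE_distrD[OF measurable_fst]) (simp only: distr_steinhaus_pair_fst AE_steinhaus_vec)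
  show "AE ww in steinhaus_pair n. \<forall>k<n. cmod (snd ww k) = 1"
    by (rule AE_distrD[OF measurable_snd]) (simp only: distr_steinhaus_pair_snd AE_steinhaus_vec)
qed

text \<open>The signs are absorbed into w', whose law they do not change; this lets a mean over S be
  introduced without loss.\<close>

lemma tetra_mix_rotate:
  "tetra_mix n m x w' w S = tetra_mix n m x (\<lambda>k. of_real (rad_sign S k) * w' k) w {}"
  unfolding tetra_mix_def scaleR_scaleC_left by (simp add: rad_sign_def)

lemma continuous_on_tetra_mix:
  fixes f g :: "'b::topological_space \<Rightarrow> nat \<Rightarrow> complex"
  assumes "continuous_on T f" "continuous_on T g"
  shows "continuous_on T (\<lambda>t. tetra_mix n m x (f t) (g t) S)"
  unfolding tetra_mix_def
  by (intro continuous_on_sum continuous_on_scaleR continuous_on_const continuous_on_scaleC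
      continuous_on_coordinate[OF assms(1)] continuous_on_tetra(2)[OF assms(2)])

lemma fin_dep_tetra_mix: "fin_dep n (\<lambda>w'. tetra_mix n m x w' w S)"
  unfolding fin_dep_def tetra_mix_def by (intro allI impI sum.cong refl) simp

lemma fin_dep_tetra_mix_right:
  assumes "\<And>k. k < n \<Longrightarrow> w1 k = w2 k"
  shows "tetra_mix n m x w' w1 S = tetra_mix n m x w' w2 S"
proof -
  have "tetra_partial n m x k w1 = tetra_partial n m x k w2" for k
    by (rule fin_depD[OF fin_dep_tetra(2)]) (rule assms)
  then show ?thesis by (simp add: tetra_mix_def)
qed

lemma fin_dep_tetra_rad: "fin_dep n (\<lambda>w. tetra_rad n m x w S)"
  unfolding fin_dep_def tetra_mix_diag[symmetric]
proof (intro allI impI)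
  fix w w' :: "nat \<Rightarrow> complex" assume *: "\<forall>k<n. w k = w' k"
  have "tetra_mix n m x w w S = tetra_mix n m x w' w S"
    by (rule fin_depD[OF fin_dep_tetra_mix]) (use * in simp)
  also have "\<dots> = tetra_mix n m x w' w' S"
    by (rule fin_dep_tetra_mix_right) (use * in simp)
  finally show "tetra_mix n m x w w S = tetra_mix n m x w' w' S" .
qed

lemma continuous_on_tetra_rad: "continuous_on UNIV (\<lambda>w. tetra_rad n m x w S)"
  unfolding tetra_mix_diag[symmetric] by (rule continuous_on_tetra_mix[OF continuous_on_id continuous_on_id])

lemma integrable_tetra_mix:
  assumes "0 < p"
  shows "integrable (steinhaus_pair n) (\<lambda>ww. norm (tetra_mix n m x (fst ww) (snd ww) S) powr p)"
proof (rule steinhaus_pair.P.integrable_const_bound)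
  show "AE ww in steinhaus_pair n. norm (norm (tetra_mix n m x (fst ww) (snd ww) S) powr p)
      \<le> (real n * coeff_norm n m x) powr p"
    using AE_steinhaus_pair by eventually_elim (use assms in \<open>auto intro!: powr_mono2 norm_tetra_mix_le\<close>)
  \<comment> \<open>Extension by zero again leads into all sequences, now in both variables at
    once.\<close>
  let ?e = "\<lambda>w k. if k < n then w k else 0 :: complex"
  have "(\<lambda>ww. norm (tetra_mix n m x (?e (fst ww)) (?e (snd ww)) S) powr p) \<in> borel_measurable (steinhaus_pair n)"
    by (rule borel_measurable_continuous_Pair[where H = "\<lambda>w' w. norm (tetra_mix n m x w' w S) powr p",
          OF measurable_compose[OF measurable_fst zero_extension_measurable]
             measurable_compose[OF measurable_snd zero_extension_measurable]])
      (intro continuous_on_norm_powr continuous_on_tetra_mix continuous_on_fst continuous_on_snd continuous_on_id assms)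
  moreover have "tetra_mix n m x (?e w') (?e w) S = tetra_mix n m x w' w S" for w' w
    using fin_depD[OF fin_dep_tetra_mix, of n "?e w'" w' m x "?e w" S]
      fin_dep_tetra_mix_right[of n "?e w" w m x w' S] by simp
  ultimately show "(\<lambda>ww. norm (tetra_mix n m x (fst ww) (snd ww) S) powr p) \<in> borel_measurable (steinhaus_pair n)"
    by simp
qed

lemma fin_dep_norm_powr: "fin_dep n f \<Longrightarrow> fin_dep n (\<lambda>w. norm (f w) powr p)"
  unfolding fin_dep_def by metis

lemma continuous_on_mult_coords: "continuous_on UNIV (\<lambda>w k. v k * w k :: complex)"
  by (intro continuous_on_coordinatewise_then_product continuous_on_mult continuous_on_const
      continuous_on_product_coordinates)

lemma integrable_rotated:
  assumes f: "continuous_on UNIV f" "fin_dep n f" and p: "0 < p"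
    and B: "\<And>w. (\<And>k. k < n \<Longrightarrow> cmod (w k) = 1) \<Longrightarrow> norm (f w) \<le> B"
    and v: "\<And>k. k < n \<Longrightarrow> cmod (v k) = 1"
  shows "integrable (steinhaus_vec n) (\<lambda>w. norm (f (\<lambda>k. v k * w k)) powr p)"
proof (rule steinhaus_vec.integrable_const_bound)
  show "AE w in steinhaus_vec n. norm (norm (f (\<lambda>k. v k * w k)) powr p) \<le> B powr p"
    using AE_steinhaus_vec by eventually_elim (use p v in \<open>auto intro!: powr_mono2 B simp: norm_mult\<close>)
  show "(\<lambda>w. norm (f (\<lambda>k. v k * w k)) powr p) \<in> borel_measurable (steinhaus_vec n)"
  proof (rule fin_dep_measurable)
    show "continuous_on UNIV (\<lambda>w. norm (f (\<lambda>k. v k * w k)) powr p)"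
      by (intro continuous_on_norm_powr[OF _ p] continuous_on_compose2[OF f(1) continuous_on_mult_coords]) simp
    show "fin_dep n (\<lambda>w. norm (f (\<lambda>k. v k * w k)) powr p)"
      using f(2) by (intro fin_dep_norm_powr) (auto simp: fin_dep_def)
  qed
qed

lemma integrable_tetra_poly:
  assumes "0 < p" "\<And>k. k < n \<Longrightarrow> cmod (v k) = 1"
  shows "integrable (steinhaus_vec n) (\<lambda>w. norm (tetra_poly n m x (\<lambda>k. v k * w k)) powr p)"
  by (rule integrable_rotated[where f = "tetra_poly n m x" and B = "coeff_norm n m x",
        OF continuous_on_tetra(1)[OF continuous_on_id] fin_dep_tetra(1) assms(1) norm_tetra_le(1) assms(2)])

lemma integrable_tetra_rad:
  assumes "0 < p" "\<And>k. k < n \<Longrightarrow> cmod (v k) = 1"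
  shows "integrable (steinhaus_vec n) (\<lambda>w. norm (tetra_rad n m x (\<lambda>k. v k * w k) S) powr p)"
proof (rule integrable_rotated[where f = "\<lambda>w. tetra_rad n m x w S" and B = "real n * coeff_norm n m x"])
  show "norm (tetra_rad n m x w S) \<le> real n * coeff_norm n m x" if "\<And>k. k < n \<Longrightarrow> cmod (w k) = 1" for w
    unfolding tetra_mix_diag[symmetric] by (rule norm_tetra_mix_le) (use that in auto)
qed (auto intro: continuous_on_tetra_rad fin_dep_tetra_rad assms)

lemma integral_cube_avg:
  assumes "\<And>S. integrable M (f S)"
  shows "(\<integral>w. cube_avg n (\<lambda>S. f S w) \<partial>M) = cube_avg n (\<lambda>S. \<integral>w. f S w \<partial>M)"
    and "integrable M (\<lambda>w. cube_avg n (\<lambda>S. f S w))"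
  unfolding cube_avg_def using assms by simp_all

lemma cube_avg_const: "cube_avg n (\<lambda>_. a) = a"
  by (simp add: cube_avg_def card_Pow)

lemma integral_tetra_poly_cube_avg:
  assumes "0 < p" "\<And>S k. cmod (v S k) = 1"
  shows "(\<integral>w. cube_avg n (\<lambda>S. norm (tetra_poly n m x (\<lambda>k. v S k * w k)) powr p) \<partial>steinhaus_vec n)
    = (\<integral>w. norm (tetra_poly n m x w) powr p \<partial>steinhaus_vec n)"
proof -
  have "(\<integral>w. norm (tetra_poly n m x (\<lambda>k. v S k * w k)) powr p \<partial>steinhaus_vec n)
    = (\<integral>w. norm (tetra_poly n m x w) powr p \<partial>steinhaus_vec n)" for S
    using assms by (intro integral_steinhaus_vec_rotate[where f = "\<lambda>w. norm (tetra_poly n m x w) powr p"]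
        continuous_on_norm_powr continuous_intros fin_dep_norm_powr) auto
  then show ?thesis
    by (subst integral_cube_avg(1)) (simp_all add: integrable_tetra_poly assms cube_avg_const)
qed

lemma integral_tetra_rad_cube_avg:
  assumes "0 < p" "\<And>S k. cmod (v S k) = 1"
  shows "(\<integral>w. cube_avg n (\<lambda>S. norm (tetra_rad n m x (\<lambda>k. v S k * w k) S) powr p) \<partial>steinhaus_vec n)
    = (\<integral>w. cube_avg n (\<lambda>S. norm (tetra_rad n m x w S) powr p) \<partial>steinhaus_vec n)"
proof -
  have "(\<integral>w. norm (tetra_rad n m x (\<lambda>k. v S k * w k) S) powr p \<partial>steinhaus_vec n)
    = (\<integral>w. norm (tetra_rad n m x w S) powr p \<partial>steinhaus_vec n)" for S
    using assms by (intro integral_steinhaus_vec_rotate[where f = "\<lambda>w. norm (tetra_rad n m x w S) powr p"]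
        continuous_on_norm_powr continuous_on_tetra_rad fin_dep_norm_powr fin_dep_tetra_rad) auto
  then show ?thesis
    using integrable_tetra_rad[OF assms(1), of n "\<lambda>_. 1"]
    by (subst (1 2) integral_cube_avg(1)) (simp_all add: integrable_tetra_rad assms)
qed

text \<open>Fubini puts the integral over w' inside. For fixed w and S the signs merely rotate w',
  so all terms of the mean over S are equal.\<close>

lemma integral_tetra_mix_cube_avg:
  assumes "0 < p"
  shows "(\<integral>ww. cube_avg n (\<lambda>S. norm (tetra_mix n m x (fst ww) (snd ww) S) powr p) \<partial>steinhaus_pair n)
    = (\<integral>ww. norm (tetra_mix n m x (fst ww) (snd ww) {}) powr p \<partial>steinhaus_pair n)"
proof -
  have fub: "(\<integral>ww. norm (tetra_mix n m x (fst ww) (snd ww) S) powr p \<partial>steinhaus_pair n)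
    = (\<integral>w. \<integral>w'. norm (tetra_mix n m x w' w S) powr p \<partial>steinhaus_vec n \<partial>steinhaus_vec n)" for S
    using steinhaus_pair.integral_snd[of n "\<lambda>w' w. norm (tetra_mix n m x w' w S) powr p"]
      integrable_tetra_mix[OF assms, of n m x S] by (simp add: case_prod_unfold)
  have *: "(\<integral>w'. norm (tetra_mix n m x w' w S) powr p \<partial>steinhaus_vec n)
    = (\<integral>w'. norm (tetra_mix n m x w' w {}) powr p \<partial>steinhaus_vec n)" for w S
    unfolding tetra_mix_rotate[of n m x _ w S]
    using assms by (intro integral_steinhaus_vec_rotate[where f = "\<lambda>w'. norm (tetra_mix n m x w' w {}) powr p"]
        continuous_on_norm_powr continuous_on_tetra_mix continuous_intros fin_dep_norm_powr fin_dep_tetra_mix)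
      (auto simp: rad_sign_def)
  have **: "(\<integral>ww. norm (tetra_mix n m x (fst ww) (snd ww) S) powr p \<partial>steinhaus_pair n)
    = (\<integral>ww. norm (tetra_mix n m x (fst ww) (snd ww) {}) powr p \<partial>steinhaus_pair n)" for S
    unfolding fub by (rule Bochner_Integration.integral_cong[OF refl *])
  have "(\<integral>ww. cube_avg n (\<lambda>S. norm (tetra_mix n m x (fst ww) (snd ww) S) powr p) \<partial>steinhaus_pair n)
    = cube_avg n (\<lambda>S. \<integral>ww. norm (tetra_mix n m x (fst ww) (snd ww) {}) powr p \<partial>steinhaus_pair n)"
    by (subst integral_cube_avg(1)[OF integrable_tetra_mix[OF assms]])
      (intro arg_cong[where f = "cube_avg n"] ext **)
  then show ?thesis by (simp only: cube_avg_const)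
qed

text \<open>The quotients \<open>u k / v k\<close> are unimodular, so the contraction principle
  exchanges v for u. As u and v may change places, the comparison works in both directions.\<close>

lemma tetra_mix_contraction:
  assumes "1 \<le> p" "\<And>k. k < n \<Longrightarrow> cmod (u k) = 1" "\<And>k. k < n \<Longrightarrow> cmod (v k) = 1"
  shows "cube_avg n (\<lambda>S. norm (tetra_mix n m x u w S) powr p)
    \<le> (pi / 2) powr p * cube_avg n (\<lambda>S. norm (tetra_mix n m x v w S) powr p)"
proof -
  have nz: "v k \<noteq> 0" if "k < n" for k using assms(3)[OF that] by auto
  have "tetra_mix n m x u w S
    = (\<Sum>k<n. rad_sign S k *\<^sub>R ((u k / v k) *\<^sub>C v k *\<^sub>C tetra_partial n m x k w))" for S
    unfolding tetra_mix_def using nz by (intro sum.cong refl) (simp add: scaleC_scaleC)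
  then show ?thesis
    using rademacher_contraction[of n "\<lambda>k. u k / v k" p "\<lambda>k. v k *\<^sub>C tetra_partial n m x k w"] assms
    by (simp add: norm_divide tetra_mix_def)
qed

text \<open>For almost all w and w' the contraction principle exchanges w' and w in the linear
  argument at the cost pi/2 either way. The mean over S can then be dropped on the side of w', where
  the signs are absorbed, but not on the side of w.\<close>

lemma integral_tetra_mix_rad:
  fixes n m :: nat and x :: "nat set \<Rightarrow> 'a::complex_normed_vector"
  assumes "1 \<le> p"
  defines "G \<equiv> \<integral>w. cube_avg n (\<lambda>S. norm (tetra_rad n m x w S) powr p) \<partial>steinhaus_vec n"
    and "H \<equiv> \<integral>ww. norm (tetra_mix n m x (fst ww) (snd ww) {}) powr p \<partial>steinhaus_pair n"
  shows "H \<le> (pi / 2) powr p * G" and "G \<le> (pi / 2) powr p * H"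
proof -
  let ?rad = "\<lambda>w. cube_avg n (\<lambda>S. norm (tetra_rad n m x w S) powr p)"
  let ?mix = "\<lambda>ww. cube_avg n (\<lambda>S. norm (tetra_mix n m x (fst ww) (snd ww) S) powr p)"
  have p: "0 < p" using assms(1) by simp
  have int_rad: "integrable (steinhaus_vec n) ?rad"
    using integrable_tetra_rad[OF p, of n "\<lambda>_. 1"] by (intro integral_cube_avg(2)) simp
  have "(\<integral>w. ?rad w \<partial>distr (steinhaus_pair n) (steinhaus_vec n) snd)
    = (\<integral>ww. ?rad (snd ww) \<partial>steinhaus_pair n)"
    by (rule integral_distr[OF measurable_snd borel_measurable_integrable[OF int_rad]])
  then have G: "G = (\<integral>ww. ?rad (snd ww) \<partial>steinhaus_pair n)"
    by (simp only: G_def distr_steinhaus_pair_snd)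
  have int_rad': "integrable (steinhaus_pair n) (\<lambda>ww. ?rad (snd ww))"
    by (rule integrable_distr[OF measurable_snd]) (simp only: distr_steinhaus_pair_snd int_rad)
  have H: "H = (\<integral>ww. ?mix ww \<partial>steinhaus_pair n)"
    unfolding H_def integral_tetra_mix_cube_avg[OF p] ..
  have int_mix: "integrable (steinhaus_pair n) ?mix"
    by (intro integral_cube_avg(2) integrable_tetra_mix p)
  show "H \<le> (pi / 2) powr p * G"
    unfolding G H
  proof (subst integral_mult_right_zero[symmetric], rule integral_mono_AE)
    show "AE ww in steinhaus_pair n. ?mix ww \<le> (pi / 2) powr p * ?rad (snd ww)"
      using AE_steinhaus_pair
      unfolding tetra_mix_diag[symmetric]
      by eventually_elim (rule tetra_mix_contraction[OF assms(1)]; simp)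
  qed (intro integrable_mult_right int_mix int_rad')+
  show "G \<le> (pi / 2) powr p * H"
    unfolding G H
  proof (subst integral_mult_right_zero[symmetric], rule integral_mono_AE)
    show "AE ww in steinhaus_pair n. ?rad (snd ww) \<le> (pi / 2) powr p * ?mix ww"
      using AE_steinhaus_pair
      unfolding tetra_mix_diag[symmetric]
      by eventually_elim (rule tetra_mix_contraction[OF assms(1)]; simp)
  qed (intro integrable_mult_right int_mix int_rad')+
qed

section \<open>The constants and the final estimates\<close>

lemma norm_cube_rot:
  assumes "c\<^sup>2 + s\<^sup>2 = 1"
  shows "cmod (cube_rot c s S k) = 1"
  using assms by (simp add: cube_rot_def cmod_def rad_sign_def)

text \<open>With k = m - 1 > 0 one has 1 - 1/m = 1/(1 + 1/k), and (1 + 1/k)^k \<le> e; the claim is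
  the square root of this. For m = 1 the base is 0 and the power is 0^0 = 1.\<close>

lemma exp_neg_half_le_power:
  fixes m :: nat
  assumes "1 \<le> m"
  shows "1 \<le> sqrt (exp 1) * sqrt (1 - 1 / real m) ^ (m - 1)"
proof -
  obtain k where m: "m = Suc k" using assms by (cases m) auto
  have "1 \<le> exp 1 * (1 - 1 / real m) ^ k"
  proof (cases "k = 0")
    case False
    then have q: "1 - 1 / real m = 1 / (1 + 1 / real k)" by (simp add: m field_simps)
    have "(1 + 1 / real k) ^ k \<le> exp (1 / real k) ^ k"
      by (intro power_mono exp_ge_add_one_self) simp
    also have "\<dots> = exp 1" using False by (simp flip: exp_of_nat_mult)
    finally show ?thesis
      unfolding q using False by (simp add: power_one_over field_simps add_pos_pos)
  qed simp
  then have "sqrt 1 \<le> sqrt (exp 1 * (1 - 1 / real m) ^ k)" by (rule real_sqrt_le_mono)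
  then show ?thesis by (simp add: real_sqrt_mult real_sqrt_power m)
qed

lemma powr_inverse_mono:
  assumes "0 < p" "0 \<le> a" "0 \<le> b" "0 \<le> X" "0 \<le> Y" "a powr p * X \<le> b powr p * (Y :: real)"
  shows "a * X powr (1 / p) \<le> b * Y powr (1 / p)"
proof -
  have "(a powr p * X) powr (1 / p) \<le> (b powr p * Y) powr (1 / p)"
    using assms by (intro powr_mono2) auto
  then show ?thesis using assms by (simp add: powr_mult powr_powr)
qed

theorem theorem4p2:
  fixes x :: "nat set \<Rightarrow> 'a::{complex_normed_vector, banach}"
    and n m :: nat and p :: real
  assumes "m \<ge> 1" and "1 \<le> p"
  shows "(\<integral>w. norm (tetra_poly n m x w) powr p \<partial>steinhaus_vec n) powr (1 / p)
           \<le> pi / 2 * sqrt (exp 1 * real m) *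
             (\<integral>ww. norm (tetra_sym n m x (\<lambda>j. if j = 0 then fst ww else snd ww)) powr p
                \<partial>(steinhaus_vec n \<Otimes>\<^sub>M steinhaus_vec n)) powr (1 / p)
         \<and> (K_convex TYPE('a) \<and> 1 < p \<longrightarrow>
         sqrt (real m) *
           (\<integral>ww. norm (tetra_sym n m x (\<lambda>j. if j = 0 then fst ww else snd ww)) powr p
              \<partial>(steinhaus_vec n \<Otimes>\<^sub>M steinhaus_vec n)) powr (1 / p)
         \<le> pi / 2 * sqrt (exp 1) * K_const p TYPE('a) *
           (\<integral>w. norm (tetra_poly n m x w) powr p \<partial>steinhaus_vec n) powr (1 / p))"
proof -
  let ?K = "K_const p TYPE('a)"
  \<comment> \<open>Here c^2 + s^2 = 1 makes the multipliers unimodular, and m s = sqrt m produces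
    the square root of m in both estimates. For m = 1, c = 0 but still a = 0^0 = 1.\<close>
  define s c a where "s = 1 / sqrt (real m)" and "c = sqrt (1 - 1 / real m)" and "a = c ^ (m - 1)"
  define Q where "Q = (\<integral>w. norm (tetra_poly n m x w) powr p \<partial>steinhaus_vec n)"
  define T where "T = (\<integral>ww. norm (tetra_sym n m x (\<lambda>j. if j = 0 then fst ww else snd ww)) powr p
      \<partial>steinhaus_pair n)"
  define H where "H = (\<integral>ww. norm (tetra_mix n m x (fst ww) (snd ww) {}) powr p \<partial>steinhaus_pair n)"
  define G where "G = (\<integral>w. cube_avg n (\<lambda>S. norm (tetra_rad n m x w S) powr p) \<partial>steinhaus_vec n)"
  have p: "0 < p" using assms(2) by simp
  have sm: "s > 0" "sqrt (real m) * s = 1" "real m * s = sqrt (real m)"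
    using assms(1) by (auto simp: s_def real_div_sqrt)
  have cs: "0 \<le> c" "c\<^sup>2 + s\<^sup>2 = 1"
    using assms(1) by (auto simp: c_def s_def power_divide)
  have v: "cmod (cube_rot c s S k) = 1" for S k by (rule norm_cube_rot[OF cs(2)])
  have a0: "0 \<le> a" using cs by (simp add: a_def)
  have a: "1 \<le> sqrt (exp 1) * a"
    unfolding a_def c_def by (rule exp_neg_half_le_power[OF assms(1)])
  have nn: "0 \<le> Q" "0 \<le> T" "0 \<le> H" "0 \<le> G"
    unfolding Q_def T_def H_def G_def by (auto intro!: Bochner_Integration.integral_nonneg cube_avg_nonneg)
  have intQ: "integrable (steinhaus_vec n) (\<lambda>w. norm (tetra_poly n m x w) powr p)"
    using integrable_tetra_poly[OF p, of n "\<lambda>_. 1"] by simp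
  have intG: "integrable (steinhaus_vec n) (\<lambda>w. cube_avg n (\<lambda>S. norm (tetra_rad n m x w S) powr p))"
    using integrable_tetra_rad[OF p, of n "\<lambda>_. 1"] by (intro integral_cube_avg(2)) simp
  have H: "H = real m powr p * T"
  proof -
    have "tetra_mix n m x w' w {} = real m *\<^sub>R tetra_sym n m x (\<lambda>j. if j = 0 then w' else w)" for w' w
      unfolding tetra_sym_eq_tetra_partial[OF assms(1)] by (simp add: tetra_mix_def rad_sign_def)
    then show ?thesis by (simp add: H_def T_def powr_mult)
  qed
  have HG: "H \<le> (pi / 2) powr p * G" "G \<le> (pi / 2) powr p * H"
    unfolding H_def G_def by (rule integral_tetra_mix_rad[OF assms(2)])+
  \<comment> \<open>P(w) is controlled pointwise by the Rademacher sum at the rotated point;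
    integrating over w removes the rotation for each sign pattern separately.\<close>
  have QG: "(real m * s * a) powr p * Q \<le> G"
  proof -
    have "(real m * s * a) powr p * Q
      = (\<integral>w. (real m * s * a * norm (tetra_poly n m x w)) powr p \<partial>steinhaus_vec n)"
      by (simp add: Q_def powr_mult)
    also have "\<dots> \<le> (\<integral>w. cube_avg n (\<lambda>S. norm (tetra_rad n m x (\<lambda>k. cube_rot c s S k * w k) S) powr p) \<partial>steinhaus_vec n)"
    proof (rule integral_mono)
      show "integrable (steinhaus_vec n) (\<lambda>w. (real m * s * a * norm (tetra_poly n m x w)) powr p)"
        using intQ by (simp add: powr_mult)
      show "integrable (steinhaus_vec n) (\<lambda>w. cube_avg n (\<lambda>S. norm (tetra_rad n m x (\<lambda>k. cube_rot c s S k * w k) S) powr p))"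
        by (intro integral_cube_avg(2) integrable_tetra_rad p v)
      show "(real m * s * a * norm (tetra_poly n m x w)) powr p
        \<le> cube_avg n (\<lambda>S. norm (tetra_rad n m x (\<lambda>k. cube_rot c s S k * w k) S) powr p)" for w
        unfolding a_def using cs sm assms(2) by (intro tetra_poly_le_cube_avg) auto
    qed
    also have "\<dots> = G"
      unfolding G_def by (rule integral_tetra_rad_cube_avg[OF p v])
    finally show ?thesis .
  qed
  \<comment> \<open>For each w the bound for R is applied to the Walsh polynomial obtained by
    substituting the multipliers into P; integration removes them on the right.\<close>
  have GQ: "(s * a) powr p * G \<le> \<bar>?K\<bar> powr p * Q" if "K_convex TYPE('a)" "1 < p"
  proof -
    have "(s * a) powr p * G
      = (\<integral>w. (s * a) powr p * cube_avg n (\<lambda>S. norm (tetra_rad n m x w S) powr p) \<partial>steinhaus_vec n)"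
      by (simp add: G_def)
    also have "\<dots> \<le> (\<integral>w. \<bar>?K\<bar> powr p * cube_avg n (\<lambda>S. norm (tetra_poly n m x (\<lambda>k. cube_rot c s S k * w k)) powr p) \<partial>steinhaus_vec n)"
      unfolding a_def using cs sm that
      by (intro integral_mono cube_avg_tetra_rad_le integrable_mult_right intG
          integral_cube_avg(2) integrable_tetra_poly p v) auto
    also have "\<dots> = \<bar>?K\<bar> powr p * Q"
      unfolding Q_def by (simp add: integral_tetra_poly_cube_avg[OF p v])
    finally show ?thesis .
  qed
  define q t g where "q = Q powr (1 / p)" and "t = T powr (1 / p)" and "g = G powr (1 / p)"
  have h: "H powr (1 / p) = real m * t"
    using nn p by (simp add: H t_def powr_mult powr_powr)
  have nn': "0 \<le> q" "0 \<le> t" "0 \<le> g" by (simp_all add: q_def t_def g_def)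
  have mt: "real m * t \<le> pi / 2 * g" and gm: "g \<le> pi / 2 * (real m * t)"
    using powr_inverse_mono[OF p, of 1 "pi / 2" H G] powr_inverse_mono[OF p, of 1 "pi / 2" G H] HG nn
    by (simp_all add: h g_def)
  have qg: "sqrt (real m) * a * q \<le> g"
    using powr_inverse_mono[OF p, of "real m * s * a" 1 Q G] QG nn sm a0 by (simp add: q_def g_def)
  have m2: "sqrt (real m) * sqrt (real m) = real m" "sqrt (real m) > 0" using assms(1) by simp_all
  \<comment> \<open>Divide sqrt m a q \<le> g \<le> (pi/2) m t by sqrt m and use 1 \<le> sqrt e
    a.\<close>
  have "q \<le> pi / 2 * sqrt (exp 1 * real m) * t"
  proof -
    have "sqrt (real m) * (a * q) \<le> sqrt (real m) * (pi / 2 * sqrt (real m) * t)"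
      using qg gm m2(1) by (simp add: mult_ac)
    then have aq: "a * q \<le> pi / 2 * sqrt (real m) * t" using m2 by simp
    have "q \<le> (sqrt (exp 1) * a) * q" using mult_right_mono[OF a nn'(1)] by simp
    also have "\<dots> \<le> sqrt (exp 1) * (pi / 2 * sqrt (real m) * t)"
      using aq by (simp add: mult.assoc)
    finally show ?thesis by (simp add: real_sqrt_mult mult_ac)
  qed
  moreover have "sqrt (real m) * t \<le> pi / 2 * sqrt (exp 1) * ?K * q" if K: "K_convex TYPE('a)" "1 < p"
  proof -
    have "s * a * g \<le> \<bar>?K\<bar> * q"
      using powr_inverse_mono[OF p, of "s * a" "\<bar>?K\<bar>" G Q] GQ[OF K] nn sm a0 by (simp add: q_def g_def)
    moreover have "s * g \<le> (sqrt (exp 1) * a) * (s * g)"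
      using mult_right_mono[OF a, of "s * g"] nn' sm by simp
    ultimately have sg: "s * g \<le> sqrt (exp 1) * (\<bar>?K\<bar> * q)"
      by (smt (verit) mult.assoc mult.commute mult_left_mono real_sqrt_ge_zero exp_ge_zero)
    \<comment> \<open>Writing sqrt m as s m exposes m t, which the contraction principle bounds by
      (pi/2) g; the factor s is what the K-convexity estimate for g needs.\<close>
    have "sqrt (real m) * t = s * (real m * t)" using sm m2 by (simp add: mult_ac)
    also have "\<dots> \<le> s * (pi / 2 * g)" using mt sm by (intro mult_left_mono) auto
    also have "\<dots> = pi / 2 * (s * g)" by simp
    also have "\<dots> \<le> pi / 2 * (sqrt (exp 1) * (\<bar>?K\<bar> * q))" by (intro mult_left_mono sg) simp
    also have "\<bar>?K\<bar> * q = ?K * q"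
    \<comment> \<open>In the zero space \<open>K_const\<close> is the supremum of the empty set and
      its sign is not determined here, but then q = 0.\<close>
    proof (cases "\<exists>b :: 'a. b \<noteq> 0")
      case True
      then show ?thesis using K_const_nonneg[OF K] by auto
    next
      case False
      then have "tetra_poly n m x w = 0" for w by blast
      then have "q = 0" by (simp add: q_def Q_def)
      then show ?thesis by simp
    qed
    finally show ?thesis by (simp add: mult.assoc)
  qed
  ultimately show ?thesis
    unfolding q_def t_def Q_def T_def by blast
qed

end
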